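(* Let $\mathfrak g$ be a complex semisimple Lie algebra, $\mathfrak g_0$ a real form of $\mathfrak g$, and $\sigma:\mathfrak g\to\mathfrak g$ the corresponding antilinear involution. With $\mathfrak t$, $\Pi=\Pi_\bullet\sqcup\Pi_\circ$, $w_\bullet$ and $\omega$ associated with $\sigma$ as in the context, the self-map of $\Pi$ defined by $$\epsilon_\sigma(\alpha)=\begin{cases}-w_\bullet(\alpha) & \text{if } \alpha\in\Pi_\bullet,\\ \omega(\alpha) & \text{if } \alpha\in\Pi_\circ,\end{cases}$$ is an automorphism of the Dynkin diagram of $\mathfrak g$.
   Context: Let $\mathfrak g_0=\mathfrak k+\mathfrak p$ be a Cartan decomposition and $\theta:\mathfrak g\to\mathfrak g$ the complex linear extension of the Cartan involution. Let $\mathfrak a\subset\mathfrak p$ be a maximal abelian subspace, $\mathfrak m$ its centralizer in $\mathfrak k$, $\mathfrak h^+$ a maximal abelian subalgebra of $\mathfrak m$, $\mathfrak h=\mathfrak h^++\mathfrak a$ and $\mathfrak t=\mathfrak h+i\mathfrak h$, a Cartan subalgebra of $\mathfrak g$ stable under $\theta$ and $\sigma$. Let $\theta^{\rm T}$ be the dual transformation of $\mathfrak t^*$: $\theta^{\rm T}(\gamma)(A)=\gamma(\theta A)$. Let $\Delta$ be the root system of $(\mathfrak g,\mathfrak t)$. All roots are real on $\mathfrak t_{\mathbb R}=i\mathfrak h^++\mathfrak a$. Choose a basis $v_1,\dots,v_r,v_{r+1},\dots,v_l$ of $\mathfrak t_{\mathbb R}$ such that $v_1,\dots,v_r$ is a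 basis of $\mathfrak a$, order $\mathfrak t_{\mathbb R}^*$ lexicographically (by the values on $v_1$, then $v_2$, etc.), and let $\Delta^+$ be the set of positive roots and $\Pi\subset\Delta^+$ the set of simple roots. Let $\Pi_\bullet=\{\alpha\in\Pi : \alpha|_{\mathfrak a}=0\}$ and $\Pi_\circ=\Pi\setminus\Pi_\bullet$. One has an involutory self-map $\omega:\Pi_\circ\to\Pi_\circ$ defined by $\theta^{\rm T}(\alpha)=-\omega(\alpha)-\sum_{\gamma\in\Pi_\bullet}c_{\alpha\gamma}\gamma$, where $c_{\alpha\gamma}$ are non-negative integers. Let $W$ be the Weyl group of $(\mathfrak g,\mathfrak t)$ acting on $\mathfrak t^*$, $W_\bullet\subset W$ the subgroup generated by the simple reflections $s_\alpha$, $\alpha\in\Pi_\bullet$, and $w_\bullet$ the element of maximal length in $W_\bullet$ with respect to these generators. One has $-w_\bullet(\alpha)\in\Pi_\bullet$ for $\alpha\in\Pi_\bullet$. *)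

theory Defs
  imports Complex_Main "HOL-Algebra.Bij" "HOL-Algebra.Generated_Groups"
begin

section \<open>Lie algebras over a field\<close>

locale lie_algebra = vector_space scale
  for scale :: "'k::field \<Rightarrow> 'g::ab_group_add \<Rightarrow> 'g" +
  fixes br :: "'g \<Rightarrow> 'g \<Rightarrow> 'g"
  assumes br_add_left: "br (x + y) z = br x z + br y z"
    and br_add_right: "br x (y + z) = br x y + br x z"
    and br_scale_left: "br (scale c x) y = scale c (br x y)"
    and br_scale_right: "br x (scale c y) = scale c (br x y)"
    and br_self: "br x x = 0"
    and jacobi: "br x (br y z) + br y (br z x) + br z (br x y) = 0"
begin

definition lie_subalgebra :: "'g set \<Rightarrow> bool" where
  "lie_subalgebra S \<longleftrightarrow> subspace S \<and> (\<forall>x\<in>S. \<forall>y\<in>S. br x y \<in> S)"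

definition lie_ideal :: "'g set \<Rightarrow> bool" where
  "lie_ideal S \<longleftrightarrow> subspace S \<and> (\<forall>x. \<forall>y\<in>S. br x y \<in> S)"

definition lie_derived :: "'g set \<Rightarrow> 'g set" where
  "lie_derived S = span {br x y | x y. x \<in> S \<and> y \<in> S}"

definition lie_solvable :: "'g set \<Rightarrow> bool" where
  "lie_solvable S \<longleftrightarrow> (\<exists>n. (lie_derived ^^ n) S = {0})"

definition lie_semisimple :: bool where
  "lie_semisimple \<longleftrightarrow> (\<forall>I. lie_ideal I \<and> lie_solvable I \<longrightarrow> I = {0})"

definition lie_abelian :: "'g set \<Rightarrow> bool" where
  "lie_abelian S \<longleftrightarrow> (\<forall>x\<in>S. \<forall>y\<in>S. br x y = 0)"

text \<open>Abelian subspaces are automatically subalgebras, so this covers both maximal abelian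
  subspaces and maximal abelian subalgebras.\<close>

definition maximal_abelian :: "'g set \<Rightarrow> 'g set \<Rightarrow> bool" where
  "maximal_abelian P S \<longleftrightarrow> subspace S \<and> S \<subseteq> P \<and> lie_abelian S \<and>
     (\<forall>S'. subspace S' \<and> S' \<subseteq> P \<and> lie_abelian S' \<and> S \<subseteq> S' \<longrightarrow> S' = S)"

text \<open>The trace of an endomorphism \<open>f\<close> of a finite-dimensional subspace \<open>S\<close>; it does not depend on
  the chosen basis.\<close>

definition trace_on :: "'g set \<Rightarrow> ('g \<Rightarrow> 'g) \<Rightarrow> 'k" where
  "trace_on S f =
     (let B = (SOME B. independent B \<and> span B = S) in \<Sum>b\<in>B. representation B (f b) b)"

definition killing_form :: "'g set \<Rightarrow> 'g \<Rightarrow> 'g \<Rightarrow> 'k" where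
  "killing_form S x y = trace_on S (\<lambda>z. br x (br y z))"

end


section \<open>Complex Lie algebras, roots and Dynkin diagrams\<close>

locale complex_lie_algebra = lie_algebra scale br
  for scale :: "complex \<Rightarrow> 'g::ab_group_add \<Rightarrow> 'g" and br :: "'g \<Rightarrow> 'g \<Rightarrow> 'g" +
  assumes finite_dimension: "\<exists>B. finite B \<and> span B = UNIV"

text \<open>\<open>R\<close> is the underlying real Lie algebra; real forms and their subspaces are real
  subspaces.\<close>

sublocale complex_lie_algebra \<subseteq> R: lie_algebra "\<lambda>r. scale (complex_of_real r)" br
  by unfold_locales
    (auto simp: scale_right_distrib scale_left_distrib br_add_left br_add_right
      br_scale_left br_scale_right br_self jacobi)

context complex_lie_algebra
begin

definition real_form :: "'g set \<Rightarrow> bool" where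
  "real_form g0 \<longleftrightarrow> R.lie_subalgebra g0 \<and>
     (\<forall>x. \<exists>u\<in>g0. \<exists>v\<in>g0. x = u + scale \<i> v) \<and> g0 \<inter> scale \<i> ` g0 = {0}"

definition real_form_conjugation :: "'g set \<Rightarrow> ('g \<Rightarrow> 'g) \<Rightarrow> bool" where
  "real_form_conjugation g0 \<sigma> \<longleftrightarrow> (\<forall>u\<in>g0. \<forall>v\<in>g0. \<sigma> (u + scale \<i> v) = u - scale \<i> v)"

text \<open>Definiteness refers to the Killing form of the real Lie algebra \<open>g0\<close>.\<close>

definition cartan_decomposition :: "'g set \<Rightarrow> 'g set \<Rightarrow> 'g set \<Rightarrow> bool" where
  "cartan_decomposition g0 k p \<longleftrightarrow>
     R.subspace k \<and> R.subspace p \<and> g0 = {x + y | x y. x \<in> k \<and> y \<in> p} \<and> k \<inter> p = {0} \<and>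
     (\<forall>x\<in>k. \<forall>y\<in>k. br x y \<in> k) \<and> (\<forall>x\<in>k. \<forall>y\<in>p. br x y \<in> p) \<and> (\<forall>x\<in>p. \<forall>y\<in>p. br x y \<in> k) \<and>
     (\<forall>x\<in>k. x \<noteq> 0 \<longrightarrow> R.killing_form g0 x x < 0) \<and>
     (\<forall>x\<in>p. x \<noteq> 0 \<longrightarrow> R.killing_form g0 x x > 0)"

text \<open>Linear forms on the subspace \<open>t\<close> are represented by functions vanishing off \<open>t\<close>, so that
  equality of forms is equality of functions.\<close>

definition dual_space :: "'g set \<Rightarrow> ('g \<Rightarrow> complex) set" where
  "dual_space t = {f. (\<forall>x\<in>t. \<forall>y\<in>t. f (x + y) = f x + f y) \<and>
     (\<forall>c. \<forall>x\<in>t. f (scale c x) = c * f x) \<and> (\<forall>x. x \<notin> t \<longrightarrow> f x = 0)}"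

definition roots :: "'g set \<Rightarrow> ('g \<Rightarrow> complex) set" where
  "roots t = {\<alpha> \<in> dual_space t. (\<exists>A\<in>t. \<alpha> A \<noteq> 0) \<and>
     (\<exists>x. x \<noteq> 0 \<and> (\<forall>A\<in>t. br A x = scale (\<alpha> A) x))}"

text \<open>The bilinear form on the dual of \<open>t\<close> induced by the Killing form.\<close>

definition dual_vector :: "'g set \<Rightarrow> ('g \<Rightarrow> complex) \<Rightarrow> 'g" where
  "dual_vector t f = (THE H. H \<in> t \<and> (\<forall>A\<in>t. killing_form UNIV H A = f A))"

definition dual_form :: "'g set \<Rightarrow> ('g \<Rightarrow> complex) \<Rightarrow> ('g \<Rightarrow> complex) \<Rightarrow> complex" where
  "dual_form t f g = killing_form UNIV (dual_vector t f) (dual_vector t g)"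

definition cartan_number :: "'g set \<Rightarrow> ('g \<Rightarrow> complex) \<Rightarrow> ('g \<Rightarrow> complex) \<Rightarrow> complex" where
  "cartan_number t f \<alpha> = 2 * dual_form t f \<alpha> / dual_form t \<alpha> \<alpha>"

definition root_reflection :: "'g set \<Rightarrow> ('g \<Rightarrow> complex) \<Rightarrow> ('g \<Rightarrow> complex) \<Rightarrow> 'g \<Rightarrow> complex" where
  "root_reflection t \<alpha> = (\<lambda>f\<in>dual_space t. \<lambda>A. f A - cartan_number t f \<alpha> * \<alpha> A)"

text \<open>For \<open>J = roots t\<close> this is the Weyl group, so for any \<open>J \<subseteq> roots t\<close> it is the subgroup of the
  Weyl group generated by the reflections in \<open>J\<close>.\<close>

definition reflection_group ::
  "'g set \<Rightarrow> ('g \<Rightarrow> complex) set \<Rightarrow> (('g \<Rightarrow> complex) \<Rightarrow> 'g \<Rightarrow> complex) set" where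
  "reflection_group t J = generate (BijGroup (dual_space t)) (root_reflection t ` J)"

text \<open>Reflections are involutions, so words need no inverse letters.\<close>

definition word_length ::
  "'g set \<Rightarrow> ('g \<Rightarrow> complex) set \<Rightarrow> (('g \<Rightarrow> complex) \<Rightarrow> 'g \<Rightarrow> complex) \<Rightarrow> nat" where
  "word_length t J w = (LEAST n. \<exists>\<alpha>s. length \<alpha>s = n \<and> set \<alpha>s \<subseteq> J \<and>
     w = foldr (\<lambda>\<alpha> u. root_reflection t \<alpha> \<otimes>\<^bsub>BijGroup (dual_space t)\<^esub> u) \<alpha>s
           \<one>\<^bsub>BijGroup (dual_space t)\<^esub>)"

definition longest_element ::
  "'g set \<Rightarrow> ('g \<Rightarrow> complex) set \<Rightarrow> (('g \<Rightarrow> complex) \<Rightarrow> 'g \<Rightarrow> complex) \<Rightarrow> bool" where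
  "longest_element t J w \<longleftrightarrow> w \<in> reflection_group t J \<and>
     (\<forall>u\<in>reflection_group t J. word_length t J u \<le> word_length t J w)"

text \<open>Lexicographic comparison of forms taking real values on \<open>vs\<close>.\<close>

definition lex_less :: "'g list \<Rightarrow> ('g \<Rightarrow> complex) \<Rightarrow> ('g \<Rightarrow> complex) \<Rightarrow> bool" where
  "lex_less vs f g \<longleftrightarrow> (\<exists>i<length vs. (\<forall>j<i. f (vs ! j) = g (vs ! j)) \<and>
     Re (f (vs ! i)) < Re (g (vs ! i)))"

definition positive_roots :: "'g set \<Rightarrow> 'g list \<Rightarrow> ('g \<Rightarrow> complex) set" where
  "positive_roots t vs = {\<alpha> \<in> roots t. lex_less vs (\<lambda>_. 0) \<alpha>}"

definition simple_roots :: "'g set \<Rightarrow> 'g list \<Rightarrow> ('g \<Rightarrow> complex) set" where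
  "simple_roots t vs = {\<alpha> \<in> positive_roots t vs.
     \<not> (\<exists>\<beta>\<in>positive_roots t vs. \<exists>\<gamma>\<in>positive_roots t vs. \<alpha> = (\<lambda>A. \<beta> A + \<gamma> A))}"

text \<open>The Dynkin diagram on a set of simple roots: \<open>dynkin_edges\<close> is the number (a priori a complex
  number, in fact 0, 1, 2 or 3) of lines joining two distinct vertices; lines joining roots of
  different length carry an arrow from the longer to the shorter root. Root lengths are real.\<close>

definition dynkin_edges :: "'g set \<Rightarrow> ('g \<Rightarrow> complex) \<Rightarrow> ('g \<Rightarrow> complex) \<Rightarrow> complex" where
  "dynkin_edges t \<alpha> \<beta> = cartan_number t \<alpha> \<beta> * cartan_number t \<beta> \<alpha>"

definition dynkin_arrow :: "'g set \<Rightarrow> ('g \<Rightarrow> complex) \<Rightarrow> ('g \<Rightarrow> complex) \<Rightarrow> bool" where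
  "dynkin_arrow t \<alpha> \<beta> \<longleftrightarrow>
     dynkin_edges t \<alpha> \<beta> \<noteq> 0 \<and> Re (dual_form t \<alpha> \<alpha>) > Re (dual_form t \<beta> \<beta>)"

definition dynkin_automorphism ::
  "'g set \<Rightarrow> ('g \<Rightarrow> complex) set \<Rightarrow> (('g \<Rightarrow> complex) \<Rightarrow> 'g \<Rightarrow> complex) \<Rightarrow> bool" where
  "dynkin_automorphism t S \<epsilon> \<longleftrightarrow> bij_betw \<epsilon> S S \<and>
     (\<forall>\<alpha>\<in>S. \<forall>\<beta>\<in>S. \<alpha> \<noteq> \<beta> \<longrightarrow>
        dynkin_edges t (\<epsilon> \<alpha>) (\<epsilon> \<beta>) = dynkin_edges t \<alpha> \<beta> \<and>
        (dynkin_arrow t (\<epsilon> \<alpha>) (\<epsilon> \<beta>) \<longleftrightarrow> dynkin_arrow t \<alpha> \<beta>))"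

end


section \<open>The data attached to a real form\<close>

text \<open>\<open>hp\<close> is the maximal abelian subalgebra of the centralizer of \<open>a\<close> in \<open>k\<close>, \<open>\<theta>\<close> the complex
  linear extension of the Cartan involution, and the first \<open>r\<close> entries of \<open>vs\<close> span \<open>a\<close>.\<close>

locale real_form_data = complex_lie_algebra scale br
  for scale :: "complex \<Rightarrow> 'g::ab_group_add \<Rightarrow> 'g" and br :: "'g \<Rightarrow> 'g \<Rightarrow> 'g" +
  fixes g0 :: "'g set" and \<sigma> :: "'g \<Rightarrow> 'g"
    and k p :: "'g set" and \<theta> :: "'g \<Rightarrow> 'g"
    and a hp :: "'g set" and vs :: "'g list" and r :: nat
  assumes semisimple: "lie_semisimple"
    and real_form_g0: "real_form g0"
    and conjugation: "real_form_conjugation g0 \<sigma>"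
    and cartan: "cartan_decomposition g0 k p"
    and theta_linear: "Vector_Spaces.linear scale scale \<theta>"
    and theta_k: "\<And>x. x \<in> k \<Longrightarrow> \<theta> x = x"
    and theta_p: "\<And>x. x \<in> p \<Longrightarrow> \<theta> x = - x"
    and a_max: "R.maximal_abelian p a"
    and hp_max: "R.maximal_abelian {x \<in> k. \<forall>y\<in>a. br x y = 0} hp"
    and vs_distinct: "distinct vs"
    and vs_independent: "R.independent (set vs)"
    and vs_span: "R.span (set vs) = {scale \<i> x + y | x y. x \<in> hp \<and> y \<in> a}"
    and r_le: "r \<le> length vs"
    and vs_span_a: "R.span (set (take r vs)) = a"
begin

definition h :: "'g set" where
  "h = {x + y | x y. x \<in> hp \<and> y \<in> a}"

definition t :: "'g set" where
  "t = {x + scale \<i> y | x y. x \<in> h \<and> y \<in> h}"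

definition Pi_roots :: "('g \<Rightarrow> complex) set" where
  "Pi_roots = simple_roots t vs"

definition Pi_bullet :: "('g \<Rightarrow> complex) set" where
  "Pi_bullet = {\<alpha> \<in> Pi_roots. \<forall>A\<in>a. \<alpha> A = 0}"

definition Pi_circ :: "('g \<Rightarrow> complex) set" where
  "Pi_circ = Pi_roots - Pi_bullet"

definition omega :: "('g \<Rightarrow> complex) \<Rightarrow> 'g \<Rightarrow> complex" where
  "omega \<alpha> = (THE \<beta>. \<beta> \<in> Pi_circ \<and> (\<exists>c :: ('g \<Rightarrow> complex) \<Rightarrow> nat. \<forall>A\<in>t.
     \<alpha> (\<theta> A) = - \<beta> A - (\<Sum>\<gamma>\<in>Pi_bullet. of_nat (c \<gamma>) * \<gamma> A)))"

definition epsilon ::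
  "(('g \<Rightarrow> complex) \<Rightarrow> 'g \<Rightarrow> complex) \<Rightarrow> ('g \<Rightarrow> complex) \<Rightarrow> 'g \<Rightarrow> complex" where
  "epsilon w \<alpha> = (if \<alpha> \<in> Pi_bullet then - w \<alpha> else omega \<alpha>)"

end

end

theory Submission
  imports Defs
begin

text \<open>The given map turns out to be the restriction to the simple roots of a single linear map
  of the dual space of \<open>t\<close>, namely \<open>phi f = - w (\<theta>\<^sup>T f)\<close>, where \<open>w\<close> is the longest element of the
  group generated by the reflections in \<open>Pi_bullet\<close>. This map is injective, preserves the bilinear
  form and permutes the roots. It maps positive roots to positive roots (\<open>phi_P\<close>): on roots that do
  not vanish on \<open>a\<close> it does not change the restriction to \<open>a\<close>, which decides the sign because the
  lexicographic order looks at \<open>a\<close> first; on the other roots \<open>\<theta>\<^sup>T\<close> is the identity, and \<open>w\<close> makes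
  the positive ones negative. Being additive and bijective on the finite set of positive roots, it
  permutes the indecomposable ones, that is, the simple roots, and an isometry that permutes the
  simple roots is an automorphism of the diagram.

  On \<open>Pi_bullet\<close> the map \<open>phi\<close> is \<open>- w\<close>. For \<open>\<alpha>\<close> in \<open>Pi_circ\<close> the positive root \<open>\<delta> = - \<theta>\<^sup>T \<alpha>\<close>
  satisfies \<open>w \<delta> = phi \<alpha>\<close>, and \<open>w\<close> changes \<open>\<delta>\<close> by an integral combination of \<open>Pi_bullet\<close> only. So
  \<open>\<delta>\<close> is \<open>phi \<alpha>\<close> plus such a combination, whose coefficients are nonnegative because \<open>\<delta>\<close> is
  positive. By independence of the simple roots this is the relation that defines \<open>omega \<alpha>\<close>, and
  \<open>omega \<alpha> = phi \<alpha>\<close> (\<open>omega_phi\<close>).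

  The facts about roots that this needs are derived from the Cartan decomposition. The conjugation
  \<open>tau\<close> with respect to the compact real form \<open>k + \<i> p\<close> makes \<open>- B x (tau y)\<close> a positive definite
  Hermitian form on the whole algebra (\<open>B_tau_neg\<close>). It follows that the Killing form is
  nondegenerate on \<open>t\<close>, that roots are real on \<open>\<i> hp + a\<close>, that there are finitely many of them, and
  that a root vector \<open>e\<close> and a multiple of \<open>tau e\<close> span with their bracket a copy of \<open>sl\<^sub>2\<close>
  (\<open>sl2_triple\<close>). The highest weight computation in \<open>sl\<^sub>2\<close> then gives integrality of Cartan numbers,
  invariance of the roots under reflections, and roots as differences of roots at acute angles
  (\<open>root_string\<close>). The last fact makes simple roots mutually obtuse, hence independent.

  The sign of \<open>w\<close> on \<open>Pi_bullet\<close> comes from the exchange condition for words in simple reflections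
  (\<open>exchange\<close>).\<close>

section \<open>Traces and the Killing form\<close>

context lie_algebra
begin

text \<open>In contrast to \<open>trace_on\<close> the basis is a parameter, so that two bases can be compared.\<close>

definition basis_trace :: "'g set \<Rightarrow> ('g \<Rightarrow> 'g) \<Rightarrow> 'k" where
  "basis_trace B f = (\<Sum>b\<in>B. representation B (f b) b)"

lemma representation_linear_image:
  assumes C: "independent C" "span C = UNIV" "finite C" and D: "independent D" "span D = UNIV"
    and f: "Vector_Spaces.linear scale scale f"
  shows "representation D (f x) d = (\<Sum>c\<in>C. representation C x c * representation D (f c) d)"
proof -
  interpret f: Vector_Spaces.linear scale scale f by (rule f)
  have "x = (\<Sum>c\<in>C. scale (representation C x c) c)"
    using sum_representation_eq[OF C(1), of x C] C by simp
  then have "f x = f (\<Sum>c\<in>C. scale (representation C x c) c)" by simp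
  also have "\<dots> = (\<Sum>c\<in>C. scale (representation C x c) (f c))"
    by (simp add: f.sum f.scale)
  finally show ?thesis
    using D by (simp add: representation_sum representation_scale)
qed

text \<open>Both sides are the same double sum over the entries of the matrices of \<open>f\<close> and \<open>g\<close> between the
  two bases. With \<open>g\<close> the identity this is independence of the basis, with \<open>C = D\<close> it is the
  cyclicity of the trace.\<close>

lemma basis_trace_commute:
  assumes C: "independent C" "span C = UNIV" "finite C"
    and D: "independent D" "span D = UNIV" "finite D"
    and f: "Vector_Spaces.linear scale scale f" and g: "Vector_Spaces.linear scale scale g"
  shows "basis_trace C (\<lambda>x. f (g x)) = basis_trace D (\<lambda>x. g (f x))"
proof -
  have "basis_trace C (\<lambda>x. f (g x)) =
      (\<Sum>c\<in>C. \<Sum>d\<in>D. representation D (g c) d * representation C (f d) c)"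
    unfolding basis_trace_def by (subst representation_linear_image[OF D C(1,2) f]) simp
  also have "\<dots> = (\<Sum>d\<in>D. \<Sum>c\<in>C. representation C (f d) c * representation D (g c) d)"
    by (subst sum.swap) (simp add: mult.commute)
  also have "\<dots> = basis_trace D (\<lambda>x. g (f x))"
    unfolding basis_trace_def by (subst (2) representation_linear_image[OF C D(1,2) g]) simp
  finally show ?thesis .
qed

lemma basis_trace_independent:
  assumes "independent C" "span C = UNIV" "finite C"
    and "independent D" "span D = UNIV" "finite D"
    and "Vector_Spaces.linear scale scale f"
  shows "basis_trace C f = basis_trace D f"
  using basis_trace_commute[OF assms linear_id] by (simp add: id_def)

lemma spanning_if_independent_same_card:
  assumes "finite T" "independent S" "S \<subseteq> span T" "card S = card T"
  shows "span T \<subseteq> span S"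
proof -
  have S: "finite S" using independent_span_bound[OF assms(1-3)] by simp
  have "x \<in> span S" if x: "x \<in> T" for x
  proof (rule ccontr)
    assume n: "x \<notin> span S"
    then have "independent (insert x S)" "x \<notin> S"
      using assms(2) by (auto simp: independent_insert span_base)
    moreover have "insert x S \<subseteq> span T" using x assms(3) by (auto simp: span_base)
    ultimately have "card (insert x S) \<le> card T" using independent_span_bound[OF assms(1)] by blast
    then show False using S \<open>x \<notin> S\<close> assms(4) by simp
  qed
  then show ?thesis by (intro span_minimal) auto
qed

end

context complex_lie_algebra
begin

abbreviation B :: "'g \<Rightarrow> 'g \<Rightarrow> complex" where
  "B \<equiv> killing_form UNIV"

text \<open>The basis that \<open>trace_on\<close> chooses for the whole space.\<close>

definition std_basis :: "'g set" where
  "std_basis = (SOME B. independent B \<and> span B = UNIV)"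

lemma finite_independent: "independent C \<Longrightarrow> finite C"
  using finite_dimension independent_span_bound by (metis UNIV_I subsetI)

lemma std_basis: "independent std_basis" "span std_basis = UNIV" "finite std_basis"
proof -
  obtain C where "independent C" "UNIV \<subseteq> span C"
    using maximal_independent_subset[of UNIV] by metis
  then have "\<exists>C. independent C \<and> span C = UNIV" by auto
  from someI_ex[OF this] show *: "independent std_basis" "span std_basis = UNIV"
    unfolding std_basis_def by auto
  then show "finite std_basis" by (simp add: finite_independent)
qed

lemma trace_on_UNIV: "trace_on UNIV f = basis_trace std_basis f"
  by (simp add: trace_on_def basis_trace_def std_basis_def Let_def)

lemma br_zero [simp]: "br x 0 = 0" "br 0 x = 0"
  using br_add_right[of x 0 0] br_add_left[of 0 0 x] by simp_all

lemma br_minus [simp]: "br x (- y) = - br x y" "br (- x) y = - br x y"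
  using br_scale_right[of x "- 1" y] br_scale_left[of "- 1" x y] by simp_all

lemma br_diff: "br x (y - z) = br x y - br x z" "br (x - y) z = br x z - br y z"
  using br_add_right[of x y "- z"] br_add_left[of x "- y" z] by simp_all

lemma br_anti: "br x y = - br y x"
proof -
  have "br x y + br y x = 0"
    using br_self[of "x + y"] br_self[of x] br_self[of y]
    by (simp add: br_add_left br_add_right add.commute)
  then show ?thesis by (simp only: eq_neg_iff_add_eq_0)
qed

lemma br_br: "br (br x y) z = br x (br y z) - br y (br x z)"
proof -
  have "br y (br z x) = - br y (br x z)" by (subst br_anti[of z x]) simp
  moreover have "br z (br x y) = - br (br x y) z" by (rule br_anti)
  ultimately have "br x (br y z) - br y (br x z) - br (br x y) z = 0"
    using jacobi[of x y z] by simp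
  then show ?thesis by simp
qed

lemma linear_ad: "Vector_Spaces.linear scale scale (br x)"
  by unfold_locales (simp_all add: br_add_right br_scale_right)

lemma linear_ad2: "Vector_Spaces.linear scale scale (\<lambda>z. br x (br y z))"
  using Vector_Spaces.linear_compose[OF linear_ad linear_ad] by (simp add: o_def)

lemma basis_trace_add:
  "basis_trace std_basis (\<lambda>z. f z + g z) = basis_trace std_basis f + basis_trace std_basis g"
  using std_basis by (simp add: basis_trace_def representation_add sum.distrib)

lemma basis_trace_diff:
  "basis_trace std_basis (\<lambda>z. f z - g z) = basis_trace std_basis f - basis_trace std_basis g"
  using std_basis by (simp add: basis_trace_def representation_diff sum_subtractf)

lemma basis_trace_scale:
  "basis_trace std_basis (\<lambda>z. scale c (f z)) = c * basis_trace std_basis f"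
  using std_basis by (simp add: basis_trace_def representation_scale sum_distrib_left)

lemma B_add: "B (x + y) z = B x z + B y z" "B x (y + z) = B x y + B x z"
  by (simp_all add: killing_form_def trace_on_UNIV br_add_left br_add_right basis_trace_add)

lemma B_scale: "B (scale c x) z = c * B x z" "B x (scale c z) = c * B x z"
  by (simp_all add: killing_form_def trace_on_UNIV br_scale_left br_scale_right basis_trace_scale)

lemma B_zero [simp]: "B 0 x = 0" "B x 0 = 0"
  using B_scale(1)[of 0 x x] B_scale(2)[of x 0 x] by simp_all

lemma B_minus [simp]: "B (- x) y = - B x y" "B x (- y) = - B x y"
  using B_scale(1)[of "-1" x y] B_scale(2)[of x "-1" y] by simp_all

lemma B_diff: "B (x - y) z = B x z - B y z" "B x (y - z) = B x y - B x z"
  using B_add(1)[of x "- y" z] B_add(2)[of x y "- z"] by simp_all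

lemma B_sym: "B x y = B y x"
  unfolding killing_form_def trace_on_UNIV
  by (rule basis_trace_commute[OF std_basis std_basis linear_ad linear_ad])

text \<open>Write \<open>X\<close>, \<open>Y\<close>, \<open>Z\<close> for the adjoint maps. Then \<open>[X, Y] Z\<close> and \<open>X [Y, Z]\<close> differ by
  \<open>X Z Y - Y X Z\<close>, which has trace zero by cyclicity.\<close>

lemma B_invariant: "B (br x y) z = B x (br y z)"
proof -
  have "basis_trace std_basis (\<lambda>u. br y (br x (br z u))) = basis_trace std_basis (\<lambda>u. br x (br z (br y u)))"
    by (rule basis_trace_commute[OF std_basis std_basis linear_ad linear_ad2])
  then show ?thesis
    by (simp add: killing_form_def trace_on_UNIV br_br basis_trace_diff br_diff)
qed

text \<open>The adjoint map of \<open>f x\<close> is the conjugate by \<open>f\<close> of the adjoint map of \<open>x\<close>, and conjugation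
  does not change traces.\<close>

lemma B_automorphism:
  assumes lin: "Vector_Spaces.linear scale scale f" and invol: "\<And>x. f (f x) = x"
    and hom: "\<And>x y. f (br x y) = br (f x) (f y)"
  shows "B (f x) (f y) = B x y"
proof -
  have *: "br (f x) (br (f y) z) = f (br x (br y (f z)))" for z
    by (simp add: hom invol)
  have "Vector_Spaces.linear scale scale (\<lambda>z. br x (br y (f z)))"
    using Vector_Spaces.linear_compose[OF lin linear_ad2] by (simp add: o_def)
  \<comment> \<open>The involution \<open>f\<close> is its own inverse, so conjugating by \<open>f\<close> puts \<open>f\<close> on both sides.\<close>
  from basis_trace_commute[OF std_basis std_basis lin this]
  show ?thesis by (simp add: killing_form_def trace_on_UNIV * invol)
qed

lemma R_span_subset: "R.span V \<subseteq> span V"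
  by (rule R.span_minimal) (auto simp: R.subspace_def span_base span_zero span_add span_scale)

text \<open>The real and the imaginary parts of a complex linear relation give two vectors \<open>x\<close>, \<open>y\<close> of the
  real span with \<open>x + \<i> y = 0\<close>; both vanish, so that the relation is trivial.\<close>

lemma independent_if_totally_real:
  assumes V: "R.independent V" and tr: "\<And>x y. x \<in> R.span V \<Longrightarrow> y \<in> R.span V \<Longrightarrow> x + scale \<i> y = 0 \<Longrightarrow> x = 0 \<and> y = 0"
  shows "independent V"
  unfolding independent_explicit_finite_subsets
proof (intro allI impI ballI)
  fix S u v assume S: "S \<subseteq> V" "finite S" and 0: "(\<Sum>v\<in>S. scale (u v) v) = 0" and v: "v \<in> S"
  let ?x = "\<Sum>v\<in>S. scale (complex_of_real (Re (u v))) v"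
  let ?y = "\<Sum>v\<in>S. scale (complex_of_real (Im (u v))) v"
  have sp: "(\<Sum>v\<in>S. scale (complex_of_real (f v)) v) \<in> R.span V" for f
    using S by (intro R.span_sum R.span_scale R.span_base) auto
  have "?x + scale \<i> ?y = (\<Sum>v\<in>S. scale (u v) v)"
    unfolding scale_sum_right sum.distrib[symmetric]
    by (rule sum.cong) (simp_all flip: scale_left_distrib complex_eq)
  then have "?x = 0 \<and> ?y = 0"
    using tr[OF sp[of "\<lambda>v. Re (u v)"] sp[of "\<lambda>v. Im (u v)"]] 0 by simp
  then have "Re (u v) = 0" "Im (u v) = 0"
    using R.independentD[OF V S(2,1) _ v, of "\<lambda>v. Re (u v)"]
      R.independentD[OF V S(2,1) _ v, of "\<lambda>v. Im (u v)"] by blast+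
  then show "u v = 0" by (simp add: complex_eq_iff)
qed

text \<open>A real basis of \<open>g0\<close> is also a complex basis of the whole algebra, and the product of two adjoint
  maps by elements of \<open>g0\<close> has the same, real, matrix over both fields. This brings the definiteness
  of the Killing form of \<open>g0\<close> on \<open>k\<close> and \<open>p\<close> to the complex Killing form.\<close>

lemma killing_form_real_form:
  assumes g0: "real_form g0" and xy: "x \<in> g0" "y \<in> g0"
  shows "B x y = of_real (R.killing_form g0 x y)"
proof -
  have sub: "R.subspace g0" and cl: "\<And>x y. x \<in> g0 \<Longrightarrow> y \<in> g0 \<Longrightarrow> br x y \<in> g0"
    using g0 by (auto simp: real_form_def R.lie_subalgebra_def)
  define C where "C = (SOME B. R.independent B \<and> R.span B = g0)"
  obtain C0 where "C0 \<subseteq> g0" "R.independent C0" "g0 \<subseteq> R.span C0"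
    using R.maximal_independent_subset[of g0] by metis
  then have "\<exists>C. R.independent C \<and> R.span C = g0"
    using R.span_minimal[OF _ sub] by blast
  from someI_ex[OF this] have C: "R.independent C" "R.span C = g0"
    unfolding C_def by auto
  have ind: "independent C"
  proof (rule independent_if_totally_real[OF C(1)], unfold C(2))
    fix x y assume x: "x \<in> g0" and y: "y \<in> g0" and 0: "x + scale \<i> y = 0"
    then have "x = scale \<i> (- y)" by (simp add: add_eq_0_iff2)
    then have "x \<in> g0 \<inter> scale \<i> ` g0" using x y R.subspace_neg[OF sub] by blast
    then have "x = 0" using g0 by (auto simp: real_form_def)
    then show "x = 0 \<and> y = 0" using 0 by simp
  qed
  have fin: "finite C" by (rule finite_independent[OF ind])
  have "z \<in> span C" for z
  proof -
    obtain u v where "u \<in> g0" "v \<in> g0" "z = u + scale \<i> v"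
      using g0 unfolding real_form_def by metis
    moreover from this have "u \<in> span C" "v \<in> span C" using R_span_subset[of C] C(2) by auto
    ultimately show ?thesis by (simp add: span_add span_scale)
  qed
  then have sp: "span C = UNIV" by auto
  have rep: "representation C z c = of_real (R.representation C z c)" if "z \<in> g0" for z c
  proof -
    have "(\<Sum>b | R.representation C z b \<noteq> 0. scale (complex_of_real (R.representation C z b)) b) = z"
      using R.sum_nonzero_representation_eq[OF C(1)] C(2) that by simp
    then have "representation C z = (\<lambda>c. of_real (R.representation C z c))"
      by (intro representation_eqI)
        (use ind sp R.finite_representation in \<open>auto dest: R.representation_ne_zero\<close>)
    then show ?thesis by simp
  qed
  have "B x y = basis_trace C (\<lambda>z. br x (br y z))"
    unfolding killing_form_def trace_on_UNIV
    by (rule basis_trace_independent[OF std_basis ind sp fin linear_ad2])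
  also have "\<dots> = of_real (R.killing_form g0 x y)"
    unfolding basis_trace_def R.killing_form_def R.trace_on_def Let_def C_def[symmetric] of_real_sum
    using C(2) by (intro sum.cong refl rep cl xy) (auto intro: R.span_base)
  finally show ?thesis .
qed

end

section \<open>The compact conjugation\<close>

text \<open>Adjoining \<open>x\<close> to \<open>S\<close> gives an abelian subspace of \<open>P\<close> again.\<close>

lemma (in lie_algebra) maximal_abelian_mem:
  assumes max: "maximal_abelian P S" and P: "subspace P" "x \<in> P"
    and comm: "\<And>y. y \<in> S \<Longrightarrow> br x y = 0" "\<And>y. y \<in> S \<Longrightarrow> br y x = 0"
  shows "x \<in> S"
proof -
  have S: "subspace S" "S \<subseteq> P" "lie_abelian S" using max by (auto simp: maximal_abelian_def)
  let ?S = "span (insert x S)"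
  have S': "\<exists>c. y - scale c x \<in> S" if "y \<in> ?S" for y
    using that span_eq_iff[THEN iffD2, OF S(1)] by (simp add: span_breakdown_eq)
  have "lie_abelian ?S"
    unfolding lie_abelian_def
  proof (intro ballI)
    fix y z assume "y \<in> ?S" "z \<in> ?S"
    then obtain c d where c: "y - scale c x \<in> S" and d: "z - scale d x \<in> S" using S' by metis
    have "br (scale c x + (y - scale c x)) (scale d x + (z - scale d x)) = 0"
      using c d comm S(3)
      by (simp only: br_add_left br_add_right br_scale_left br_scale_right br_self lie_abelian_def) simp
    then show "br y z = 0" by simp
  qed
  moreover have "?S \<subseteq> P" using P S by (intro span_minimal) auto
  moreover have "S \<subseteq> ?S" "x \<in> ?S" using span_superset by blast+
  ultimately show ?thesis using max by (auto simp: maximal_abelian_def)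
qed

context real_form_data
begin

lemma subspaces: "R.subspace k" "R.subspace p" "R.subspace g0" "R.subspace a" "R.subspace hp"
  using cartan real_form_g0 a_max hp_max
  by (auto simp: cartan_decomposition_def real_form_def R.lie_subalgebra_def R.maximal_abelian_def)

lemma kp_g0: "x \<in> k \<Longrightarrow> x \<in> g0" "x \<in> p \<Longrightarrow> x \<in> g0"
proof -
  have *: "x + y \<in> g0" if "x \<in> k" "y \<in> p" for x y
    using cartan that unfolding cartan_decomposition_def by blast
  show "x \<in> k \<Longrightarrow> x \<in> g0" "x \<in> p \<Longrightarrow> x \<in> g0"
    using *[of x 0] *[of 0 x] R.subspace_0 subspaces by auto
qed

lemma br_kp: "x \<in> k \<Longrightarrow> y \<in> k \<Longrightarrow> br x y \<in> k" "x \<in> k \<Longrightarrow> y \<in> p \<Longrightarrow> br x y \<in> p"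
  "x \<in> p \<Longrightarrow> y \<in> k \<Longrightarrow> br x y \<in> p" "x \<in> p \<Longrightarrow> y \<in> p \<Longrightarrow> br x y \<in> k"
proof -
  have *: "\<forall>x\<in>k. \<forall>y\<in>k. br x y \<in> k" "\<forall>x\<in>k. \<forall>y\<in>p. br x y \<in> p" "\<forall>x\<in>p. \<forall>y\<in>p. br x y \<in> k"
    using cartan unfolding cartan_decomposition_def by blast+
  then show "x \<in> k \<Longrightarrow> y \<in> k \<Longrightarrow> br x y \<in> k" "x \<in> k \<Longrightarrow> y \<in> p \<Longrightarrow> br x y \<in> p"
    "x \<in> p \<Longrightarrow> y \<in> p \<Longrightarrow> br x y \<in> k" by blast+
  show "x \<in> p \<Longrightarrow> y \<in> k \<Longrightarrow> br x y \<in> p"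
    unfolding br_anti[of x y] using * by (intro R.subspace_neg[OF subspaces(2)]) blast
qed

lemma kp_sum_0: "x \<in> k \<Longrightarrow> y \<in> p \<Longrightarrow> x + y = 0 \<Longrightarrow> x = 0 \<and> y = 0"
proof -
  assume *: "x \<in> k" "y \<in> p" "x + y = 0"
  then have "x = - y" by (simp add: eq_neg_iff_add_eq_0)
  then have "x \<in> k \<inter> p" using * R.subspace_neg[OF subspaces(2)] by auto
  then have "x = 0" using cartan unfolding cartan_decomposition_def by blast
  then show ?thesis using * by simp
qed

lemma g0_sum_0: "x \<in> g0 \<Longrightarrow> y \<in> g0 \<Longrightarrow> x + scale \<i> y = 0 \<Longrightarrow> x = 0 \<and> y = 0"
proof -
  assume *: "x \<in> g0" "y \<in> g0" "x + scale \<i> y = 0"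
  then have "x = scale \<i> (- y)" by (simp add: eq_neg_iff_add_eq_0)
  then have "x \<in> g0 \<inter> scale \<i> ` g0" using * R.subspace_neg[OF subspaces(3)] by blast
  then have "x = 0" using real_form_g0 by (auto simp: real_form_def)
  then show ?thesis using * by simp
qed

lemma g0_decomp: obtains u v where "u \<in> g0" "v \<in> g0" "x = u + scale \<i> v"
  using real_form_g0 unfolding real_form_def by metis

lemma kp_decomp: assumes "x \<in> g0" obtains u v where "u \<in> k" "v \<in> p" "x = u + v"
  using cartan assms unfolding cartan_decomposition_def by blast

text \<open>Since \<open>k\<close> and \<open>p\<close> generate the algebra under addition and multiplication by \<open>\<i>\<close>, identities that
  are additive and compatible with \<open>\<i>\<close> need to be verified on \<open>k\<close> and \<open>p\<close> only.\<close>

lemma g_induct: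
  assumes k: "\<And>x. x \<in> k \<Longrightarrow> P x" and p: "\<And>x. x \<in> p \<Longrightarrow> P x"
    and add: "\<And>x y. P x \<Longrightarrow> P y \<Longrightarrow> P (x + y)" and i: "\<And>x. P x \<Longrightarrow> P (scale \<i> x)"
  shows "P x"
proof -
  have g0: "P x" if "x \<in> g0" for x by (rule kp_decomp[OF that]) (auto intro: k p add)
  show ?thesis by (rule g0_decomp[of x]) (auto intro: g0 add i)
qed

lemma theta_add: "\<theta> (x + y) = \<theta> x + \<theta> y" and theta_scale: "\<theta> (scale c x) = scale c (\<theta> x)"
  using theta_linear by (simp_all add: Vector_Spaces.linear_iff)

lemma theta_neg: "\<theta> (- x) = - \<theta> x"
  using theta_scale[of "-1" x] by simp

lemma theta_theta: "\<theta> (\<theta> x) = x"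
  by (induction x rule: g_induct) (simp_all add: theta_k theta_p theta_add theta_scale theta_neg)

lemma theta_br: "\<theta> (br x y) = br (\<theta> x) (\<theta> y)"
proof (induction x rule: g_induct)
  case (1 x)
  then show ?case
    by (induction y rule: g_induct)
      (simp_all add: theta_k theta_p theta_add theta_scale br_kp br_add_right br_scale_right)
next
  case (2 x)
  then show ?case
    by (induction y rule: g_induct)
      (simp_all add: theta_k theta_p theta_add theta_scale br_kp br_add_right br_scale_right)
qed (simp_all add: theta_add theta_scale br_add_left br_scale_left)

lemma B_theta: "B (\<theta> x) (\<theta> y) = B x y"
  by (rule B_automorphism[OF theta_linear theta_theta theta_br])

text \<open>The form is invariant under \<open>\<theta>\<close>, for which \<open>k\<close> and \<open>p\<close> are eigenspaces with different
  eigenvalues.\<close>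

lemma B_kp: "x \<in> k \<Longrightarrow> y \<in> p \<Longrightarrow> B x y = 0" "x \<in> k \<Longrightarrow> y \<in> p \<Longrightarrow> B y x = 0"
  using B_theta[of x y] B_sym[of x y] by (simp_all add: theta_k theta_p)

lemma B_g0: "x \<in> g0 \<Longrightarrow> y \<in> g0 \<Longrightarrow> B x y \<in> \<real>"
  by (simp add: killing_form_real_form[OF real_form_g0])

lemma B_k_neg: "x \<in> k \<Longrightarrow> x \<noteq> 0 \<Longrightarrow> Re (B x x) < 0"
  and B_p_pos: "x \<in> p \<Longrightarrow> x \<noteq> 0 \<Longrightarrow> Re (B x x) > 0"
proof -
  have "\<forall>x\<in>k. x \<noteq> 0 \<longrightarrow> R.killing_form g0 x x < 0" "\<forall>x\<in>p. x \<noteq> 0 \<longrightarrow> R.killing_form g0 x x > 0"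
    using cartan unfolding cartan_decomposition_def by blast+
  then show "x \<in> k \<Longrightarrow> x \<noteq> 0 \<Longrightarrow> Re (B x x) < 0" "x \<in> p \<Longrightarrow> x \<noteq> 0 \<Longrightarrow> Re (B x x) > 0"
    by (simp_all add: killing_form_real_form[OF real_form_g0] kp_g0)
qed

text \<open>The conjugation with respect to the compact real form \<open>k + \<i> p\<close>. It is an antilinear
  automorphism, and \<open>- B x (tau y)\<close> is a positive definite Hermitian form.\<close>

definition tau :: "'g \<Rightarrow> 'g" where
  "tau x = \<theta> (\<sigma> x)"

lemma sigma_eq: "u \<in> g0 \<Longrightarrow> v \<in> g0 \<Longrightarrow> \<sigma> (u + scale \<i> v) = u - scale \<i> v"
  using conjugation by (simp add: real_form_conjugation_def)

lemma sigma_add: "\<sigma> (x + y) = \<sigma> x + \<sigma> y"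
proof -
  obtain u v u' v' where *: "u \<in> g0" "v \<in> g0" "x = u + scale \<i> v" "u' \<in> g0" "v' \<in> g0" "y = u' + scale \<i> v'"
    by (metis g0_decomp)
  have "\<sigma> ((u + u') + scale \<i> (v + v')) = (u + u') - scale \<i> (v + v')"
    using * R.subspace_add[OF subspaces(3)] by (intro sigma_eq) auto
  moreover have "x + y = (u + u') + scale \<i> (v + v')"
    by (simp add: * scale_right_distrib algebra_simps)
  ultimately have "\<sigma> (x + y) = (u + u') - scale \<i> (v + v')" by simp
  then show ?thesis
    using * by (simp add: sigma_eq scale_right_distrib)
qed

lemma sigma_scale: "\<sigma> (scale c x) = scale (cnj c) (\<sigma> x)"
proof -
  obtain u v where *: "u \<in> g0" "v \<in> g0" "x = u + scale \<i> v"
    by (metis g0_decomp)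
  let ?s = "\<lambda>r. scale (complex_of_real r)"
  have c: "c = of_real (Re c) + \<i> * of_real (Im c)" by (simp add: complex_eq)
  let ?u = "?s (Re c) u - ?s (Im c) v" and ?v = "?s (Re c) v + ?s (Im c) u"
  have "?u \<in> g0" "?v \<in> g0"
    using * subspaces(3) by (auto intro!: R.subspace_add R.subspace_diff R.subspace_scale)
  then have "\<sigma> (?u + scale \<i> ?v) = ?u - scale \<i> ?v" by (rule sigma_eq)
  moreover have "scale c x = ?u + scale \<i> ?v"
    by (subst c) (simp add: * scale_right_distrib scale_left_distrib scale_right_diff_distrib algebra_simps)
  moreover have "scale (cnj c) (u - scale \<i> v) = ?u - scale \<i> ?v"
  proof -
    have "cnj c = of_real (Re c) - \<i> * of_real (Im c)" by (simp add: complex_eq_iff)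
    show ?thesis
      by (subst \<open>cnj c = _\<close>) (simp add: scale_right_distrib scale_left_distrib
        scale_left_diff_distrib algebra_simps)
  qed
  ultimately have "\<sigma> (scale c x) = scale (cnj c) (u - scale \<i> v)" by simp
  then show ?thesis using * by (simp add: sigma_eq)
qed

lemma tau_add: "tau (x + y) = tau x + tau y" and tau_scale: "tau (scale c x) = scale (cnj c) (tau x)"
  by (simp_all add: tau_def sigma_add sigma_scale theta_add theta_scale)

lemma tau_minus: "tau (- x) = - tau x"
  using tau_scale[of "-1" x] by simp

lemma tau_k: "x \<in> k \<Longrightarrow> tau x = x" and tau_p: "x \<in> p \<Longrightarrow> tau x = - x"
  using sigma_eq[of x 0] R.subspace_0[OF subspaces(3)]
  by (simp_all add: tau_def theta_k theta_p kp_g0)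

lemma tau_tau: "tau (tau x) = x"
  by (induction x rule: g_induct) (simp_all add: tau_k tau_p tau_add tau_scale tau_minus)

lemma tau_br: "tau (br x y) = br (tau x) (tau y)"
proof (induction x rule: g_induct)
  case (1 x)
  then show ?case
    by (induction y rule: g_induct)
      (simp_all add: tau_k tau_p tau_add tau_scale br_kp br_add_right br_scale_right)
next
  case (2 x)
  then show ?case
    by (induction y rule: g_induct)
      (simp_all add: tau_k tau_p tau_add tau_scale br_kp br_add_right br_scale_right)
qed (simp_all add: tau_add tau_scale br_add_left br_scale_left)

text \<open>In \<open>x = k1 + p1 + \<i> (k2 + p2)\<close> the mixed terms cancel by symmetry and by orthogonality of \<open>k\<close> and
  \<open>p\<close>; what remains is a sum of squares, each with the sign given by the Cartan decomposition.\<close>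

lemma B_tau_neg:
  assumes "x \<noteq> 0" shows "Re (B x (tau x)) < 0" "B x (tau x) \<in> \<real>"
proof -
  obtain u v where uv: "u \<in> g0" "v \<in> g0" "x = u + scale \<i> v" by (rule g0_decomp)
  obtain k1 p1 where 1: "k1 \<in> k" "p1 \<in> p" "u = k1 + p1" using uv by (metis kp_decomp)
  obtain k2 p2 where 2: "k2 \<in> k" "p2 \<in> p" "v = k2 + p2" using uv by (metis kp_decomp)
  have x: "x = k1 + p1 + scale \<i> (k2 + p2)" by (simp add: uv 1 2)
  have t: "tau x = k1 - p1 + scale (- \<i>) (k2 - p2)"
    using 1 2 by (simp add: x tau_add tau_scale tau_k tau_p)
  have e: "B x (tau x) = B k1 k1 - B p1 p1 + B k2 k2 - B p2 p2"
    unfolding t unfolding x using 1 2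
    by (simp add: B_add B_diff B_scale B_kp B_sym[of k2 k1] B_sym[of p2 p1] algebra_simps)
  then show "B x (tau x) \<in> \<real>" using 1 2 by (simp add: B_g0 kp_g0)
  have le: "x \<in> k \<Longrightarrow> Re (B x x) \<le> 0" "x \<in> p \<Longrightarrow> Re (B x x) \<ge> 0" for x
    using B_k_neg[of x] B_p_pos[of x] by (cases "x = 0"; force)+
  have "k1 \<noteq> 0 \<or> p1 \<noteq> 0 \<or> k2 \<noteq> 0 \<or> p2 \<noteq> 0" using assms x by auto
  then show "Re (B x (tau x)) < 0"
    using le(1)[OF 1(1)] le(1)[OF 2(1)] le(2)[OF 1(2)] le(2)[OF 2(2)]
      B_k_neg[OF 1(1)] B_k_neg[OF 2(1)] B_p_pos[OF 1(2)] B_p_pos[OF 2(2)]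
    by (simp add: e) linarith
qed

section \<open>The Cartan subalgebra\<close>

text \<open>The real form of \<open>t\<close> on which the roots are real and the Killing form is positive definite.\<close>

definition tR :: "'g set" where
  "tR = {scale \<i> x + y | x y. x \<in> hp \<and> y \<in> a}"

lemma a_sub: "x \<in> a \<Longrightarrow> x \<in> p" and hp_sub: "x \<in> hp \<Longrightarrow> x \<in> k"
  using a_max hp_max by (auto simp: R.maximal_abelian_def)

lemma tRI: "x \<in> hp \<Longrightarrow> scale \<i> x \<in> tR" "x \<in> a \<Longrightarrow> x \<in> tR"
  using R.subspace_0[OF subspaces(4)] R.subspace_0[OF subspaces(5)]
  unfolding tR_def by force+

lemma tRE: assumes "A \<in> tR" obtains x y where "x \<in> hp" "y \<in> a" "A = scale \<i> x + y"
  using assms by (auto simp: tR_def)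

lemma tR_eq_span: "tR = R.span (set vs)"
  by (simp add: tR_def vs_span)

lemma subspace_tR: "R.subspace tR"
  by (simp add: tR_eq_span)

lemma t_eq: "t = {x + scale \<i> y | x y. x \<in> tR \<and> y \<in> tR}"
proof (intro equalityI subsetI)
  fix A assume "A \<in> t"
  then obtain x y x' y' where *: "x \<in> hp" "y \<in> a" "x' \<in> hp" "y' \<in> a"
      "A = (x + y) + scale \<i> (x' + y')"
    by (auto simp: t_def h_def)
  have "A = (scale \<i> x' + y) + scale \<i> (scale \<i> (- x) + y')"
    by (simp add: * algebra_simps scale_right_distrib)
  moreover have "- x \<in> hp" using * subspaces by (auto intro: R.subspace_neg)
  ultimately show "A \<in> {x + scale \<i> y | x y. x \<in> tR \<and> y \<in> tR}"
    using * unfolding tR_def by blast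
next
  fix A assume "A \<in> {x + scale \<i> y | x y. x \<in> tR \<and> y \<in> tR}"
  then obtain x y x' y' where *: "x \<in> hp" "y \<in> a" "x' \<in> hp" "y' \<in> a"
      "A = (scale \<i> x + y) + scale \<i> (scale \<i> x' + y')"
    by (auto simp: tR_def)
  have "A = (- x' + y) + scale \<i> (x + y')"
    by (simp add: * algebra_simps scale_right_distrib)
  moreover have "- x' \<in> hp" using * subspaces by (auto intro: R.subspace_neg)
  ultimately show "A \<in> t"
    using * unfolding t_def h_def by blast
qed

lemma tE: assumes "A \<in> t" obtains x y where "x \<in> tR" "y \<in> tR" "A = x + scale \<i> y"
  using assms by (auto simp: t_eq)

lemma tI: "x \<in> tR \<Longrightarrow> y \<in> tR \<Longrightarrow> x + scale \<i> y \<in> t"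
  by (auto simp: t_eq)

lemma tR_t: "x \<in> tR \<Longrightarrow> x \<in> t"
  using tI[of x 0] R.subspace_0[OF subspace_tR] by simp

lemma t_eq_span: "t = span (set vs)"
proof
  show "t \<subseteq> span (set vs)"
    using R_span_subset[of "set vs"] by (auto simp: t_eq tR_eq_span intro!: span_add span_scale)
  have "scale c x \<in> t" if "x \<in> tR" for c x
  proof -
    have eq: "scale c x = scale (of_real (Re c)) x + scale \<i> (scale (of_real (Im c)) x)"
      by (simp flip: scale_left_distrib complex_eq)
    show ?thesis unfolding eq by (intro tI R.subspace_scale[OF subspace_tR] that)
  qed
  note sc = this
  have add: "x + y \<in> t" if "x \<in> t" "y \<in> t" for x y
  proof -
    obtain x1 x2 y1 y2 where *: "x1 \<in> tR" "x2 \<in> tR" "y1 \<in> tR" "y2 \<in> tR"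
        "x = x1 + scale \<i> x2" "y = y1 + scale \<i> y2"
      using \<open>x \<in> t\<close> \<open>y \<in> t\<close> by (metis tE)
    have "x + y = (x1 + y1) + scale \<i> (x2 + y2)" by (simp add: * scale_right_distrib algebra_simps)
    also have "\<dots> \<in> t" using * by (intro tI R.subspace_add[OF subspace_tR])
    finally show ?thesis .
  qed
  have "subspace t"
    unfolding subspace_def
  proof (intro conjI ballI allI)
    show "0 \<in> t" using R.subspace_0[OF subspace_tR] by (rule tR_t)
    show "x + y \<in> t" if "x \<in> t" "y \<in> t" for x y using that by (rule add)
    show "scale c x \<in> t" if "x \<in> t" for c x
    proof (rule tE[OF that])
      fix x1 x2 assume "x1 \<in> tR" "x2 \<in> tR" "x = x1 + scale \<i> x2"
      then show "scale c x \<in> t" using add[OF sc[of x1 c] sc[of x2 "c * \<i>"]]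
        by (simp add: scale_right_distrib)
    qed
  qed
  then show "span (set vs) \<subseteq> t"
    by (intro span_minimal) (auto intro!: tR_t simp: tR_eq_span R.span_base)
qed

lemma subspace_t: "subspace t"
  by (simp add: t_eq_span)

lemma tau_tR: "A \<in> tR \<Longrightarrow> tau A = - A"
  by (auto elim!: tRE simp: tau_add tau_scale tau_k tau_p a_sub hp_sub)

lemma B_tR_real: "A \<in> tR \<Longrightarrow> A' \<in> tR \<Longrightarrow> B A A' \<in> \<real>"
  by (auto elim!: tRE simp: B_add B_scale B_kp a_sub hp_sub B_g0 kp_g0)

lemma B_tR_pos: "A \<in> tR \<Longrightarrow> A \<noteq> 0 \<Longrightarrow> Re (B A A) > 0"
  using B_tau_neg(1)[of A] by (simp add: tau_tR)

lemma theta_tR: "A \<in> tR \<Longrightarrow> \<theta> A \<in> tR"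
proof -
  assume "A \<in> tR"
  then obtain x y where *: "x \<in> hp" "y \<in> a" "A = scale \<i> x + y" by (rule tRE)
  then have "\<theta> A = scale \<i> x + (- y)"
    by (simp add: theta_add theta_scale theta_k theta_p a_sub hp_sub)
  moreover have "- y \<in> a" using * by (intro R.subspace_neg[OF subspaces(4)])
  ultimately show ?thesis using * unfolding tR_def by blast
qed

lemma theta_t: "\<theta> A \<in> t \<longleftrightarrow> A \<in> t"
proof -
  have "\<theta> A \<in> t" if "A \<in> t" for A
    using that by (auto elim!: tE simp: theta_add theta_scale intro!: tI theta_tR)
  from this[of A] this[of "\<theta> A"] show ?thesis by (auto simp: theta_theta)
qed

lemma tau_t: "A \<in> t \<Longrightarrow> tau A \<in> t"
proof -
  assume "A \<in> t"
  then obtain x y where *: "x \<in> tR" "y \<in> tR" "A = x + scale \<i> y" by (rule tE)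
  then have "tau A = (- x) + scale \<i> y"
    by (simp add: tau_add tau_scale tau_tR)
  also have "\<dots> \<in> t" using * by (intro tI R.subspace_neg[OF subspace_tR])
  finally show ?thesis .
qed

text \<open>Both \<open>a\<close> and \<open>hp\<close> respect the decompositions into \<open>g0\<close> and \<open>\<i> g0\<close> and into \<open>k\<close> and \<open>p\<close>, so the
  components of \<open>x\<close> commute with them separately. Those in \<open>p\<close> lie in \<open>a\<close> by maximality of \<open>a\<close>, and
  those in \<open>k\<close> lie in \<open>hp\<close> by maximality of \<open>hp\<close>.\<close>

lemma centralizer_t:
  assumes "\<And>A. A \<in> t \<Longrightarrow> br A x = 0"
  shows "x \<in> t"
proof -
  obtain u v where uv: "u \<in> g0" "v \<in> g0" "x = u + scale \<i> v" by (rule g0_decomp)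
  have g0br: "br x y \<in> g0" if "x \<in> g0" "y \<in> g0" for x y
    using that real_form_g0 by (auto simp: real_form_def R.lie_subalgebra_def)
  have x: "br A x = 0" if "A \<in> a \<or> A \<in> hp" for A
  proof -
    have "scale \<i> A \<in> t \<or> A \<in> t" using that by (auto intro: tR_t tRI)
    then have "br (scale \<i> A) x = 0 \<or> br A x = 0" using assms by blast
    then show ?thesis by (auto simp: br_scale_left)
  qed
  have real: "w \<in> h" if w: "w \<in> g0" "\<And>A. A \<in> a \<Longrightarrow> br A w = 0" "\<And>A. A \<in> hp \<Longrightarrow> br A w = 0" for w
  proof -
    obtain y z where yz: "y \<in> k" "z \<in> p" "w = y + z" using w by (metis kp_decomp)
    have a: "br A y = 0 \<and> br A z = 0" if A: "A \<in> a" for A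
      using kp_sum_0[of "br A z" "br A y"] w(2)[OF A] yz br_kp a_sub[OF A]
      by (simp add: br_add_right add.commute)
    have hp: "br A y = 0 \<and> br A z = 0" if A: "A \<in> hp" for A
      using kp_sum_0[of "br A y" "br A z"] w(3)[OF A] yz br_kp hp_sub[OF A]
      by (simp add: br_add_right)
    have sw: "br A B = 0 \<Longrightarrow> br B A = 0" for A B using br_anti[of B A] by simp
    have "z \<in> a" by (rule R.maximal_abelian_mem[OF a_max subspaces(2) yz(2)]) (use a sw in auto)
    moreover have "R.subspace {x \<in> k. \<forall>y\<in>a. br x y = 0}"
      using subspaces(1) by (auto simp: R.subspace_def br_add_left br_scale_left)
    then have "y \<in> hp" by (rule R.maximal_abelian_mem[OF hp_max]) (use yz a hp sw in auto)
    ultimately show ?thesis using yz by (auto simp: h_def)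
  qed
  have "br A u = 0 \<and> br A v = 0" if "A \<in> a \<or> A \<in> hp" for A
    using g0_sum_0[of "br A u" "br A v"] g0br uv x[OF that] that
    by (auto simp: br_add_right br_scale_right a_sub hp_sub kp_g0)
  then have "u \<in> h" "v \<in> h" using uv real by auto
  then show ?thesis using uv by (auto simp: t_def)
qed

end

section \<open>Root strings\<close>

context complex_lie_algebra
begin

text \<open>With \<open>v_j\<close> the \<open>j\<close>-th image of \<open>v\<close> under lowering one has \<open>[e, v_(j+1)] = (j + 1) (m - j) v_j\<close>.
  If \<open>v_(n+1)\<close> is the first vector that vanishes, the factor \<open>m - n\<close> must be zero.\<close>

lemma sl2_highest_weight:
  assumes ef: "br e f = h" and hf: "br h f = scale (- 2) f"
    and v: "v \<noteq> 0" "br e v = 0" "br h v = scale m v" and nil: "(br f ^^ N) v = 0"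
  shows "\<exists>n. m = of_nat n \<and> (\<forall>j\<le>n. (br f ^^ j) v \<noteq> 0)"
proof -
  let ?v = "\<lambda>j. (br f ^^ j) v"
  have h: "br h (?v j) = scale (m - 2 * of_nat j) (?v j)" for j
  proof (induction j)
    case (Suc j)
    have "br h (br f (?v j)) = br (br h f) (?v j) + br f (br h (?v j))"
      by (simp add: br_br)
    also have "\<dots> = scale (- 2 + (m - 2 * of_nat j)) (br f (?v j))"
      by (simp only: hf Suc br_scale_left br_scale_right scale_left_distrib)
    finally show ?case by (simp add: algebra_simps)
  qed (simp add: v)
  have e: "br e (?v (Suc j)) = scale (of_nat (Suc j) * (m - of_nat j)) (?v j)" for j
  proof (induction j)
    case 0
    show ?case using br_br[of e f v] ef v by simp
  next
    case (Suc j)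
    have "br e (br f (?v (Suc j))) = br (br e f) (?v (Suc j)) + br f (br e (?v (Suc j)))"
      by (simp only: br_br) simp
    also have "\<dots> = scale ((m - 2 * of_nat (Suc j)) + of_nat (Suc j) * (m - of_nat j)) (?v (Suc j))"
      using h[of "Suc j"] Suc by (simp del: of_nat_Suc add: ef br_scale_right scale_left_distrib)
    also have "(m - 2 * of_nat (Suc j)) + of_nat (Suc j) * (m - of_nat j) =
        of_nat (Suc (Suc j)) * (m - of_nat (Suc j))"
      by (simp add: algebra_simps)
    finally show ?case by simp
  qed
  define M where "M = (LEAST j. ?v j = 0)"
  have M: "?v M = 0" "j < M \<Longrightarrow> ?v j \<noteq> 0" for j
    using LeastI[of "\<lambda>j. ?v j = 0", OF nil] not_less_Least[of j "\<lambda>j. ?v j = 0"]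
    by (auto simp: M_def)
  obtain n where n: "M = Suc n" using M(1) v(1) by (cases M) auto
  have "scale (of_nat (Suc n) * (m - of_nat n)) (?v n) = 0"
    using e[of n] M(1) n by simp
  then have "m = of_nat n" using M(2)[of n] n by (simp del: of_nat_Suc)
  then show ?thesis using M(2) n by (auto simp: less_Suc_eq_le)
qed

lemma dual_space_add:
  "f \<in> dual_space T \<Longrightarrow> g \<in> dual_space T \<Longrightarrow> (\<lambda>A. f A + c * g A) \<in> dual_space T"
  by (auto simp: dual_space_def algebra_simps)

lemma dual_space_diff:
  "f \<in> dual_space T \<Longrightarrow> g \<in> dual_space T \<Longrightarrow> (\<lambda>A. f A - c * g A) \<in> dual_space T"
  using dual_space_add[of f T g "- c"] by simp

lemma dual_space_0: "(\<lambda>A. 0) \<in> dual_space T"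
  by (auto simp: dual_space_def)

lemma dual_space_uminus: "f \<in> dual_space T \<Longrightarrow> - f \<in> dual_space T"
  using dual_space_diff[of "\<lambda>_. 0" T f 1] by (simp add: dual_space_0 fun_Compl_def)

end

context real_form_data
begin

abbreviation dv :: "('g \<Rightarrow> complex) \<Rightarrow> 'g" where
  "dv \<equiv> dual_vector t"

abbreviation D :: "('g \<Rightarrow> complex) set" where
  "D \<equiv> dual_space t"

abbreviation cn :: "('g \<Rightarrow> complex) \<Rightarrow> ('g \<Rightarrow> complex) \<Rightarrow> complex" where
  "cn \<equiv> cartan_number t"

abbreviation df :: "('g \<Rightarrow> complex) \<Rightarrow> ('g \<Rightarrow> complex) \<Rightarrow> complex" where
  "df \<equiv> dual_form t"

definition weight_vector :: "('g \<Rightarrow> complex) \<Rightarrow> 'g \<Rightarrow> bool" where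
  "weight_vector f x \<longleftrightarrow> x \<noteq> 0 \<and> (\<forall>A\<in>t. br A x = scale (f A) x)"

text \<open>Zero is admitted as a weight, because root strings may pass through it.\<close>

definition weights :: "('g \<Rightarrow> complex) set" where
  "weights = {f \<in> D. \<exists>x. weight_vector f x}"

lemma dual_add: "f \<in> D \<Longrightarrow> x \<in> t \<Longrightarrow> y \<in> t \<Longrightarrow> f (x + y) = f x + f y"
  and dual_scale: "f \<in> D \<Longrightarrow> x \<in> t \<Longrightarrow> f (scale c x) = c * f x"
  and dual_off: "f \<in> D \<Longrightarrow> x \<notin> t \<Longrightarrow> f x = 0"
  by (auto simp: dual_space_def)

lemma dual_0: "f \<in> D \<Longrightarrow> f 0 = 0"
  using dual_scale[of f 0 0] subspace_0[OF subspace_t] by simp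

lemma dual_eqI:
  assumes f: "f \<in> D" "g \<in> D" and eq: "\<And>v. v \<in> set vs \<Longrightarrow> f v = g v"
  shows "f = g"
proof
  fix x show "f x = g x"
  proof (cases "x \<in> t")
    case True
    have "subspace {x \<in> t. f x = g x}"
      using subspace_t f by (auto simp: subspace_def dual_add dual_scale dual_0)
    moreover have "set vs \<subseteq> {x \<in> t. f x = g x}"
      using eq by (auto simp: t_eq_span span_base)
    ultimately show ?thesis using True span_minimal by (auto simp: t_eq_span)
  qed (simp add: f dual_off)
qed

lemma vs_tR: "v \<in> set vs \<Longrightarrow> v \<in> tR"
  by (simp add: tR_eq_span R.span_base)

lemma weights_0_roots: "roots t = weights - {\<lambda>_. 0}"
  by (auto simp: roots_def weights_def weight_vector_def dual_off fun_eq_iff) (metis dual_off)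

lemma roots_weights: "f \<in> roots t \<Longrightarrow> f \<in> weights" and weights_D: "f \<in> weights \<Longrightarrow> f \<in> D"
  by (auto simp: weights_0_roots weights_def)

lemma roots_D: "f \<in> roots t \<Longrightarrow> f \<in> D"
  by (simp add: roots_weights weights_D)

text \<open>The conjugation is \<open>-1\<close> on \<open>tR\<close>, hence it sends weight vectors to vectors whose weight is the
  negative of the conjugate.\<close>

lemma tau_weight_vector:
  assumes "weight_vector g y" "A \<in> tR"
  shows "br A (tau y) = scale (- cnj (g A)) (tau y)"
proof -
  have "br A (tau y) = - br (tau A) (tau y)" using assms by (simp add: tau_tR)
  also have "\<dots> = - tau (br A y)" by (simp add: tau_br)
  also have "br A y = scale (g A) y" using assms by (simp add: weight_vector_def tR_t)
  finally show ?thesis by (simp add: tau_scale)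
qed

text \<open>This is self-adjointness of the adjoint map of \<open>A\<close> for the Hermitian form given by \<open>tau\<close>. It makes
  weights real on \<open>tR\<close> and weight vectors of different weights orthogonal.\<close>

lemma weight_vectors_orthogonal:
  assumes "weight_vector f x" "weight_vector g y" "A \<in> tR"
  shows "f A * B x (tau y) = cnj (g A) * B x (tau y)"
proof -
  have "f A * B x (tau y) = B (br A x) (tau y)"
    using assms by (simp add: weight_vector_def tR_t B_scale)
  also have "\<dots> = - B (br x A) (tau y)" by (subst br_anti) simp
  also have "\<dots> = - B x (br A (tau y))" by (simp add: B_invariant)
  finally show ?thesis using tau_weight_vector[OF assms(2,3)] by (simp add: B_scale)
qed

lemma B_tau_nonzero: "x \<noteq> 0 \<Longrightarrow> B x (tau x) \<noteq> 0"
  using B_tau_neg(1)[of x] by auto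

lemma weight_real: "f \<in> weights \<Longrightarrow> A \<in> tR \<Longrightarrow> f A \<in> \<real>"
proof -
  assume f: "f \<in> weights" and A: "A \<in> tR"
  then obtain x where x: "weight_vector f x" by (auto simp: weights_def)
  then have "B x (tau x) \<noteq> 0" by (simp add: weight_vector_def B_tau_nonzero)
  then have "f A = cnj (f A)" using weight_vectors_orthogonal[OF x x A] by simp
  then show ?thesis by (simp add: Reals_cnj_iff)
qed

lemma weight_vectors_orthogonal':
  assumes "weight_vector f x" "weight_vector g y" "f \<in> weights" "g \<in> weights" "f \<noteq> g"
  shows "B x (tau y) = 0"
proof (rule ccontr)
  assume "B x (tau y) \<noteq> 0"
  then have "f A = g A" if "A \<in> tR" for A
    using weight_vectors_orthogonal[OF assms(1,2) that] weight_real[OF assms(4) that]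
    by (simp add: Reals_cnj_iff)
  then have "f = g" using assms by (intro dual_eqI) (auto simp: vs_tR weights_D)
  then show False using assms by simp
qed

text \<open>Nonzero orthogonal vectors for a definite form are linearly independent, so there are at most as many
  weights as the dimension.\<close>

lemma finite_weights: "finite weights"
proof -
  define x where "x f = (SOME x. weight_vector f x)" for f
  have x: "weight_vector f (x f)" if "f \<in> weights" for f
    using that unfolding weights_def x_def by (auto intro: someI)
  have x0: "B (x f) (tau (x f)) \<noteq> 0" if "f \<in> weights" for f
    using x[OF that] by (simp add: weight_vector_def B_tau_nonzero)
  have orth: "B (x f) (tau (x g)) = 0" if "f \<in> weights" "g \<in> weights" "f \<noteq> g" for f g
    using that by (intro weight_vectors_orthogonal'[of f _ g]) (auto simp: x)
  have inj: "inj_on x weights"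
    using x0 orth by (metis inj_onI)
  have "independent (x ` weights)"
    unfolding independent_explicit_finite_subsets
  proof (intro allI impI ballI)
    fix S u v assume S: "S \<subseteq> x ` weights" "finite S" and 0: "(\<Sum>v\<in>S. scale (u v) v) = 0" and v: "v \<in> S"
    have B_sum: "B (\<Sum>v\<in>S. scale (u v) v) z = (\<Sum>v\<in>S. u v * B v z)" for z
      using S(2) by (induction S) (simp_all add: B_add B_scale)
    have "0 = (\<Sum>w\<in>S. u w * B w (tau v))" using B_sum[of "tau v"] 0 by simp
    also have "\<dots> = (\<Sum>w\<in>S. if w = v then u v * B v (tau v) else 0)"
    proof (rule sum.cong[OF refl])
      fix w assume "w \<in> S"
      then obtain f g where "f \<in> weights" "w = x f" "g \<in> weights" "v = x g" using S(1) v by blast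
      then show "u w * B w (tau v) = (if w = v then u v * B v (tau v) else 0)"
        using orth[of f g] by auto
    qed
    also have "\<dots> = u v * B v (tau v)" using S v by simp
    finally show "u v = 0" using x0 S v by auto
  qed
  then show ?thesis using finite_independent finite_imageD inj by blast
qed

text \<open>Since \<open>tau\<close> preserves \<open>t\<close>, the vector \<open>tau x\<close> is a test vector that detects \<open>x\<close>.\<close>

lemma B_t_nondegenerate:
  assumes "x \<in> t" "\<And>v. v \<in> set vs \<Longrightarrow> B x v = 0" shows "x = 0"
proof -
  have "subspace {y. B x y = 0}" by (auto simp: subspace_def B_add B_scale)
  then have "t \<subseteq> {y. B x y = 0}" unfolding t_eq_span using assms by (intro span_minimal) auto
  then have "B x (tau x) = 0" using tau_t[OF assms(1)] by auto
  then show ?thesis using B_tau_nonzero by blast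
qed

lemma independent_vs: "independent (set vs)"
proof (rule independent_if_totally_real[OF vs_independent], fold tR_eq_span)
  fix x y assume xy: "x \<in> tR" "y \<in> tR" "x + scale \<i> y = 0"
  have "tau (x + scale \<i> y) = - x + scale \<i> y"
    using xy(1,2) by (simp add: tau_add tau_scale tau_tR)
  moreover have "tau 0 = 0" using tau_scale[of 0 0] by simp
  ultimately have "scale \<i> y = x" using xy by simp
  then have "scale 2 x = 0" using xy(3) by (metis one_add_one scale_left_distrib scale_one)
  then show "x = 0 \<and> y = 0" using xy by simp
qed

text \<open>The map \<open>T\<close> that sends \<open>x\<close> to the vector with coordinates \<open>B x b\<close> is injective on \<open>t\<close> by
  nondegeneracy. It therefore maps \<open>t\<close> onto itself, and the vector with coordinates \<open>f b\<close> is in its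
  image.\<close>

lemma riesz:
  assumes f: "f \<in> D"
  shows "\<exists>H\<in>t. \<forall>A\<in>t. B H A = f A"
proof -
  define T where "T x = (\<Sum>b\<in>set vs. scale (B x b) b)" for x
  interpret pair: vector_space_pair scale scale ..
  have lin: "Vector_Spaces.linear scale scale T"
    by unfold_locales
      (simp_all add: T_def B_add B_scale scale_left_distrib sum.distrib scale_sum_right)
  interpret T: Vector_Spaces.linear scale scale T by (rule lin)
  have coeff: "\<forall>b\<in>set vs. u b = w b" if "(\<Sum>b\<in>set vs. scale (u b) b) = (\<Sum>b\<in>set vs. scale (w b) b)" for u w
  proof
    fix b assume b: "b \<in> set vs"
    have "(\<Sum>b\<in>set vs. scale (u b - w b) b) = 0"
      using that by (simp add: scale_left_diff_distrib sum_subtractf)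
    from independentD[OF independent_vs finite_set order.refl this b] have "u b - w b = 0" .
    then show "u b = w b" by simp
  qed
  have comb: "(\<Sum>b\<in>set vs. scale (u b) b) \<in> span (set vs)" for u
    by (intro span_sum span_scale span_base)
  have inj: "inj_on T (span (set vs))"
  proof (rule inj_onI)
    fix x y assume "x \<in> span (set vs)" "y \<in> span (set vs)" "T x = T y"
    then have "x - y = 0"
      using coeff[of "B x" "B y"]
      by (intro B_t_nondegenerate) (auto simp: t_eq_span span_diff T_def B_diff)
    then show "x = y" by simp
  qed
  have "independent (T ` set vs)"
    by (rule pair.linear_independent_injective_image[OF lin independent_vs inj])
  moreover have "T ` set vs \<subseteq> span (set vs)"
    by (auto simp: T_def comb)
  moreover have "card (T ` set vs) = card (set vs)"
    by (rule card_image) (rule inj_on_subset[OF inj span_superset])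
  ultimately have "span (set vs) \<subseteq> span (T ` set vs)"
    by (intro spanning_if_independent_same_card) auto
  then have "(\<Sum>b\<in>set vs. scale (f b) b) \<in> T ` span (set vs)"
    unfolding T.span_image by (rule subsetD) (rule comb)
  then obtain H where H: "H \<in> t" "(\<Sum>b\<in>set vs. scale (f b) b) = T H"
    unfolding t_eq_span by blast
  have eq: "\<forall>b\<in>set vs. f b = B H b" using coeff[OF H(2)[unfolded T_def]] .
  have "subspace {x \<in> t. f x = B H x}"
    using subspace_t f by (auto simp: subspace_def dual_add dual_scale dual_0 B_add B_scale)
  then have "span (set vs) \<subseteq> {x \<in> t. f x = B H x}"
    using eq by (intro span_minimal) (auto simp: vs_tR tR_t)
  then show ?thesis using H(1) unfolding t_eq_span by force
qed

lemma dual_vectorI: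
  assumes H: "H \<in> t" "\<And>A. A \<in> t \<Longrightarrow> B H A = f A"
  shows "dv f = H"
  unfolding dual_vector_def
proof (rule the_equality)
  fix H' assume H': "H' \<in> t \<and> (\<forall>A\<in>t. B H' A = f A)"
  have "H' - H = 0"
    using H H' subspace_diff[OF subspace_t]
    by (intro B_t_nondegenerate) (auto simp: B_diff vs_tR tR_t)
  then show "H' = H" by simp
qed (use H in auto)

lemma dual_vector: assumes "f \<in> D" shows "dv f \<in> t" "A \<in> t \<Longrightarrow> B (dv f) A = f A"
proof -
  obtain H where H: "H \<in> t" "\<And>A. A \<in> t \<Longrightarrow> B H A = f A" using riesz[OF assms] by blast
  then show "dv f \<in> t" "A \<in> t \<Longrightarrow> B (dv f) A = f A" using dual_vectorI[OF H] by auto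
qed

lemma dual_form_eval: "f \<in> D \<Longrightarrow> g \<in> D \<Longrightarrow> df f g = f (dv g)"
  by (simp add: dual_form_def dual_vector)

lemma dual_form_sym: "df f g = df g f"
  by (simp add: dual_form_def B_sym)

lemma dual_form_add: "f \<in> D \<Longrightarrow> g \<in> D \<Longrightarrow> l \<in> D \<Longrightarrow> df (\<lambda>A. f A + c * g A) l = df f l + c * df g l"
  by (simp add: dual_form_eval dual_space_add)

text \<open>The imaginary part of the dual vector is orthogonal to \<open>tR\<close>, where the form is definite.\<close>

lemma dual_vector_tR: assumes "f \<in> D" "\<And>A. A \<in> tR \<Longrightarrow> f A \<in> \<real>" shows "dv f \<in> tR"
proof -
  obtain u v where uv: "u \<in> tR" "v \<in> tR" "dv f = u + scale \<i> v"
    using dual_vector(1)[OF assms(1)] by (rule tE)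
  have "f v = B u v + \<i> * B v v"
    using dual_vector(2)[OF assms(1), of v] uv by (simp add: tR_t B_add B_scale)
  then have "Im (B u v + \<i> * B v v) = 0"
    using assms(2)[OF uv(2)] by (metis complex_is_Real_iff)
  then have "Re (B v v) = 0"
    using B_tR_real[OF uv(1,2)] by (simp add: complex_is_Real_iff)
  then have "v = 0" using B_tR_pos[OF uv(2)] by force
  then show ?thesis using uv by simp
qed

lemma dual_form_real:
  assumes "f \<in> D" "\<And>A. A \<in> tR \<Longrightarrow> f A \<in> \<real>" "g \<in> D" "\<And>A. A \<in> tR \<Longrightarrow> g A \<in> \<real>"
  shows "df f g \<in> \<real>"
  unfolding dual_form_def by (intro B_tR_real dual_vector_tR assms)

lemma dual_form_pos:
  assumes "f \<in> D" "\<And>A. A \<in> tR \<Longrightarrow> f A \<in> \<real>" "f \<noteq> (\<lambda>_. 0)"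
  shows "Re (df f f) > 0"
proof -
  have "dv f \<noteq> 0"
  proof
    assume "dv f = 0"
    then have "f A = 0" for A
      using dual_vector(2)[OF assms(1), of A] dual_off[OF assms(1), of A] by (cases "A \<in> t") auto
    then show False using assms by auto
  qed
  then show ?thesis
    unfolding dual_form_def by (intro B_tR_pos dual_vector_tR assms)
qed

lemma root_norm_pos: "\<alpha> \<in> roots t \<Longrightarrow> Re (df \<alpha> \<alpha>) > 0" "\<alpha> \<in> roots t \<Longrightarrow> df \<alpha> \<alpha> \<noteq> 0"
  using dual_form_pos[of \<alpha>] by (force simp: weights_0_roots weights_D weight_real)+

text \<open>For a root vector \<open>e\<close> one may take \<open>f\<close> to be a multiple of \<open>tau e\<close>. The bracket of \<open>e\<close> and \<open>tau e\<close>
  commutes with \<open>t\<close>, hence lies in \<open>t\<close>, and invariance of the Killing form identifies it as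
  \<open>B e (tau e)\<close> times the dual vector of \<open>\<alpha>\<close>. The scalar is not zero because the Hermitian form is
  definite.\<close>

lemma sl2_triple:
  assumes \<alpha>: "\<alpha> \<in> roots t"
  obtains e f h where "br e f = h" "h \<in> t" "\<And>\<beta>. \<beta> \<in> D \<Longrightarrow> \<beta> h = cn \<beta> \<alpha>"
    "weight_vector \<alpha> e" "weight_vector (- \<alpha>) f"
proof -
  obtain e where e: "weight_vector \<alpha> e" using roots_weights[OF \<alpha>] by (auto simp: weights_def)
  have aD: "\<alpha> \<in> D" using \<alpha> by (rule roots_D)
  have real: "br A (tau e) = scale (- \<alpha> A) (tau e)" if "A \<in> tR" for A
    using tau_weight_vector[OF e that] weight_real[OF roots_weights[OF \<alpha>] that]
    by (simp add: Reals_cnj_iff)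
  have te: "br A (tau e) = scale (- \<alpha> A) (tau e)" if At: "A \<in> t" for A
  proof -
    obtain x y where xy: "x \<in> tR" "y \<in> tR" "A = x + scale \<i> y" using At by (rule tE)
    then have "\<alpha> A = \<alpha> x + \<i> * \<alpha> y"
      by (simp add: dual_add[OF aD] dual_scale[OF aD] tR_t subspace_scale[OF subspace_t])
    then show ?thesis
      by (simp add: xy real br_add_left br_scale_left scale_left_diff_distrib)
  qed
  have e0: "e \<noteq> 0" using e by (simp add: weight_vector_def)
  let ?b = "B e (tau e)"
  have b: "?b \<noteq> 0" by (rule B_tau_nonzero[OF e0])
  have eA: "br A e = scale (\<alpha> A) e" if "A \<in> t" for A using e that by (simp add: weight_vector_def)
  have "br e (tau e) \<in> t"
  proof (rule centralizer_t)
    fix A assume A: "A \<in> t"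
    have "br A (br e (tau e)) = br (br A e) (tau e) + br e (br A (tau e))" by (simp add: br_br)
    then show "br A (br e (tau e)) = 0" using A by (simp add: te eA br_scale_left br_scale_right)
  qed
  moreover have "B (br e (tau e)) A = ?b * \<alpha> A" if A: "A \<in> t" for A
  proof -
    have "B (br e (tau e)) A = B e (br (tau e) A)" by (rule B_invariant)
    also have "\<dots> = - B e (br A (tau e))" by (subst br_anti) simp
    finally show ?thesis using A by (simp add: te B_scale)
  qed
  ultimately have "dv \<alpha> = scale (1 / ?b) (br e (tau e))"
    using b by (intro dual_vectorI) (auto simp: subspace_scale[OF subspace_t] B_scale)
  then have br: "br e (tau e) = scale ?b (dv \<alpha>)" using b by simp
  define h where "h = scale (2 / df \<alpha> \<alpha>) (dv \<alpha>)"
  show ?thesis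
  proof
    show "br e (scale (2 / (df \<alpha> \<alpha> * ?b)) (tau e)) = h"
      using b by (simp add: br_scale_right br h_def)
    show "h \<in> t" using dual_vector(1)[OF aD] by (simp add: h_def subspace_scale[OF subspace_t])
    show "\<beta> h = cn \<beta> \<alpha>" if "\<beta> \<in> D" for \<beta>
      using that aD by (simp add: h_def dual_scale dual_vector cartan_number_def dual_form_eval)
    show "weight_vector \<alpha> e" by (rule e)
    have "tau e \<noteq> 0" using e0 tau_tau[of e] tau_scale[of 0 e] by auto
    then show "weight_vector (- \<alpha>) (scale (2 / (df \<alpha> \<alpha> * ?b)) (tau e))"
      using b root_norm_pos(2)[OF \<alpha>]
      by (auto simp: weight_vector_def br_scale_right te mult.commute)
  qed
qed

lemma weight_vector_br:
  assumes "weight_vector f x" "weight_vector g y" "br x y \<noteq> 0"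
  shows "weight_vector (\<lambda>A. g A + f A) (br x y)"
proof -
  have "br A (br x y) = scale (g A + f A) (br x y)" if "A \<in> t" for A
  proof -
    have "br A (br x y) = br (br A x) y + br x (br A y)" by (simp add: br_br)
    then show ?thesis using assms that
      by (simp add: weight_vector_def br_scale_left br_scale_right scale_left_distrib add.commute)
  qed
  then show ?thesis using assms by (simp add: weight_vector_def)
qed

lemma weight_vector_funpow:
  assumes "weight_vector f x" "weight_vector g y" "(br x ^^ n) y \<noteq> 0"
  shows "weight_vector (\<lambda>A. g A + of_nat n * f A) ((br x ^^ n) y)"
  using assms(3)
proof (induction n)
  case (Suc n)
  then have "(br x ^^ n) y \<noteq> 0" by (auto)
  then have "weight_vector (\<lambda>A. (g A + of_nat n * f A) + f A) (br x ((br x ^^ n) y))"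
    using Suc assms by (intro weight_vector_br) auto
  then show ?case by (simp add: algebra_simps)
qed (simp add: assms)

text \<open>Otherwise the iterates would have infinitely many different weights.\<close>

lemma weight_vector_nilpotent:
  assumes "weight_vector f x" "weight_vector g y" "f \<in> D" "g \<in> D" "f \<noteq> (\<lambda>_. 0)"
  shows "\<exists>n. (br x ^^ n) y = 0"
proof (rule ccontr)
  assume "\<not> ?thesis"
  then have "(\<lambda>A. g A + of_nat n * f A) \<in> weights" for n :: nat
    using weight_vector_funpow[OF assms(1,2)] dual_space_add[OF assms(4,3)] by (auto simp: weights_def)
  then have "range (\<lambda>n::nat. (\<lambda>A. g A + of_nat n * f A)) \<subseteq> weights" by auto
  moreover obtain A where "f A \<noteq> 0" using assms(5) by auto
  then have "inj (\<lambda>n::nat. (\<lambda>A. g A + of_nat n * f A))"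
    by (auto intro!: injI dest: fun_cong[where x = A])
  ultimately show False
    using finite_weights finite_subset finite_imageD[of _ "UNIV :: nat set"] infinite_UNIV_nat by blast
qed

text \<open>Raise a weight vector of \<open>\<beta>\<close> as far as possible, in \<open>s\<close> steps, to a highest weight vector of
  weight \<open>\<beta> + s \<alpha>\<close>. On the coroot this weight takes the value \<open>cn \<beta> \<alpha> + 2 s\<close>, which therefore is
  the length \<open>n\<close> of the string below it.\<close>

lemma root_string:
  assumes \<alpha>: "\<alpha> \<in> roots t" and \<beta>: "\<beta> \<in> weights"
  obtains s n :: nat where "cn \<beta> \<alpha> + 2 * of_nat s = of_nat n"
    "\<And>j. j \<le> n \<Longrightarrow> (\<lambda>A. \<beta> A + (of_nat s - of_nat j) * \<alpha> A) \<in> weights"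
proof -
  obtain e f h where ef: "br e f = h" "h \<in> t" and h: "\<And>\<beta>. \<beta> \<in> D \<Longrightarrow> \<beta> h = cn \<beta> \<alpha>"
    and e: "weight_vector \<alpha> e" and f: "weight_vector (- \<alpha>) f"
    using sl2_triple[OF \<alpha>] by metis
  have aD: "\<alpha> \<in> D" and bD: "\<beta> \<in> D" using \<alpha> \<beta> roots_D weights_D by auto
  have a0: "\<alpha> \<noteq> (\<lambda>_. 0)" using \<alpha> by (auto simp: weights_0_roots)
  have ma0: "- \<alpha> \<noteq> (\<lambda>_. 0)" using a0 by (auto simp: fun_eq_iff)
  obtain x where x: "weight_vector \<beta> x" using \<beta> by (auto simp: weights_def)
  \<comment> \<open>The successor makes \<open>s\<close> the last exponent for which the iterate does not vanish.\<close>
  define s where "s = (LEAST n. (br e ^^ Suc n) x = 0)"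
  obtain n0 where "(br e ^^ n0) x = 0" using weight_vector_nilpotent[OF e x aD bD a0] by blast
  then have "(br e ^^ Suc n0) x = 0" by simp
  then have s: "(br e ^^ Suc s) x = 0" unfolding s_def by (rule LeastI)
  define v where "v = (br e ^^ s) x"
  have v0: "v \<noteq> 0"
  proof (cases s)
    case 0
    then show ?thesis using x by (simp add: v_def weight_vector_def)
  next
    case (Suc q)
    then show ?thesis using not_less_Least[of q "\<lambda>n. (br e ^^ Suc n) x = 0"] by (simp add: v_def s_def)
  qed
  define \<mu> where "\<mu> = (\<lambda>A. \<beta> A + of_nat s * \<alpha> A)"
  have \<mu>: "weight_vector \<mu> v" "\<mu> \<in> D"
    using weight_vector_funpow[OF e x] v0 dual_space_add[OF bD aD] by (auto simp: v_def \<mu>_def)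
  obtain N where N: "(br f ^^ N) v = 0"
    using weight_vector_nilpotent[OF f \<mu>(1) dual_space_uminus[OF aD] \<mu>(2) ma0] by blast
  have "\<alpha> h = 2" using h[OF aD] root_norm_pos(2)[OF \<alpha>] by (simp add: cartan_number_def)
  then have hf: "br h f = scale (- 2) f" using f ef by (simp add: weight_vector_def)
  have "br e v = 0" using s by (simp add: v_def)
  moreover have "br h v = scale (\<mu> h) v" using \<mu> ef by (simp add: weight_vector_def)
  ultimately obtain n where n: "\<mu> h = of_nat n" "\<forall>j\<le>n. (br f ^^ j) v \<noteq> 0"
    using sl2_highest_weight[OF ef(1) hf v0 _ _ N] by blast
  show ?thesis
  proof
    show "cn \<beta> \<alpha> + 2 * of_nat s = of_nat n"
      using n(1) h[OF bD] \<open>\<alpha> h = 2\<close> by (simp add: \<mu>_def mult.commute)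
    fix j assume "j \<le> n"
    then have "weight_vector (\<lambda>A. \<mu> A + of_nat j * (- \<alpha>) A) ((br f ^^ j) v)"
      using n by (intro weight_vector_funpow[OF f \<mu>(1)]) auto
    moreover have "(\<lambda>A. \<mu> A + of_nat j * (- \<alpha>) A) = (\<lambda>A. \<beta> A + (of_nat s - of_nat j) * \<alpha> A)"
      by (simp add: \<mu>_def algebra_simps fun_eq_iff)
    ultimately show "(\<lambda>A. \<beta> A + (of_nat s - of_nat j) * \<alpha> A) \<in> weights"
      using dual_space_add[OF bD aD] by (auto simp: weights_def)
  qed
qed

lemma cartan_number_Ints: "\<alpha> \<in> roots t \<Longrightarrow> \<beta> \<in> weights \<Longrightarrow> cn \<beta> \<alpha> \<in> \<int>"
proof -
  assume "\<alpha> \<in> roots t" "\<beta> \<in> weights"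
  then obtain s n :: nat where "cn \<beta> \<alpha> + 2 * of_nat s = of_nat n" by (rule root_string)
  then have "cn \<beta> \<alpha> = of_nat n - 2 * of_nat s" by (simp add: algebra_simps)
  then show ?thesis by simp
qed

lemma uminus_root: "\<alpha> \<in> roots t \<Longrightarrow> - \<alpha> \<in> roots t"
proof -
  assume \<alpha>: "\<alpha> \<in> roots t"
  obtain f where "weight_vector (- \<alpha>) f" using sl2_triple[OF \<alpha>] by metis
  then show ?thesis
    using \<alpha> dual_space_uminus[OF roots_D[OF \<alpha>]] by (auto simp: weights_0_roots weights_def fun_eq_iff)
qed

lemma cartan_number_uminus:
  assumes "\<alpha> \<in> D" "\<beta> \<in> D" shows "cn \<beta> (- \<alpha>) = - cn \<beta> \<alpha>"
proof -
  have u: "df (- \<alpha>) h = - df \<alpha> h" if "h \<in> D" for h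
    using that assms by (simp add: dual_form_eval dual_space_uminus)
  have "df \<beta> (- \<alpha>) = - df \<beta> \<alpha>" using u[OF assms(2)] by (simp add: dual_form_sym)
  moreover have "df (- \<alpha>) (- \<alpha>) = df \<alpha> \<alpha>"
    using u[of "- \<alpha>"] u[of \<alpha>] assms by (simp add: dual_space_uminus dual_form_sym[of \<alpha> "- \<alpha>"])
  ultimately show ?thesis by (simp add: cartan_number_def)
qed

text \<open>Here \<open>n = c + 2 s\<close>, so the string extends at least \<open>c\<close> steps below \<open>\<beta>\<close>.\<close>

lemma string_down:
  assumes \<alpha>: "\<alpha> \<in> roots t" and \<beta>: "\<beta> \<in> weights" and c: "cn \<beta> \<alpha> = of_nat c" and i: "i \<le> c"
  shows "(\<lambda>A. \<beta> A - of_nat i * \<alpha> A) \<in> weights"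
proof -
  obtain s n :: nat where s: "cn \<beta> \<alpha> + 2 * of_nat s = of_nat n"
    "\<And>j. j \<le> n \<Longrightarrow> (\<lambda>A. \<beta> A + (of_nat s - of_nat j) * \<alpha> A) \<in> weights" by (rule root_string[OF \<alpha> \<beta>]) (rule that)
  have "of_nat (c + 2 * s) = (of_nat n :: complex)" using s(1) c by simp
  then have "s + i \<le> n" using i unfolding of_nat_eq_iff by simp
  from s(2)[OF this] show ?thesis by (simp add: algebra_simps)
qed

text \<open>For a negative Cartan number the string is followed in the direction of \<open>\<alpha>\<close>, that is, downwards
  for the root \<open>- \<alpha>\<close>, which has the same reflection.\<close>

lemma reflection_weight:
  assumes \<alpha>: "\<alpha> \<in> roots t" and \<beta>: "\<beta> \<in> weights"
  shows "(\<lambda>A. \<beta> A - cn \<beta> \<alpha> * \<alpha> A) \<in> weights"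
proof -
  obtain c where c: "cn \<beta> \<alpha> = of_int c" using cartan_number_Ints[OF assms] by (rule Ints_cases)
  show ?thesis
  proof (cases "c \<ge> 0")
    case True
    then have eq: "cn \<beta> \<alpha> = of_nat (nat c)" using c by simp
    from string_down[OF \<alpha> \<beta> eq order.refl] show ?thesis by (simp add: eq)
  next
    case False
    then have eq: "cn \<beta> (- \<alpha>) = of_nat (nat (- c))"
      using c cartan_number_uminus[OF roots_D[OF \<alpha>] weights_D[OF \<beta>]] by simp
    from string_down[OF uminus_root[OF \<alpha>] \<beta> eq order.refl]
    show ?thesis unfolding eq[symmetric] cartan_number_uminus[OF roots_D[OF \<alpha>] weights_D[OF \<beta>]] by simp
  qed
qed

text \<open>The Cartan number is a positive integer, so the string through \<open>\<beta>\<close> has at least one step downwards.\<close>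

lemma root_diff:
  assumes \<alpha>: "\<alpha> \<in> roots t" and \<beta>: "\<beta> \<in> roots t" and pos: "Re (df \<beta> \<alpha>) > 0" and ne: "\<beta> \<noteq> \<alpha>"
  shows "(\<lambda>A. \<beta> A - \<alpha> A) \<in> roots t"
proof -
  obtain c where c: "cn \<beta> \<alpha> = of_int c"
    using cartan_number_Ints[OF \<alpha> roots_weights[OF \<beta>]] by (rule Ints_cases)
  have real: "df \<alpha> \<alpha> \<in> \<real>" "df \<beta> \<alpha> \<in> \<real>"
    using \<alpha> \<beta> by (auto intro!: dual_form_real simp: roots_D weight_real roots_weights)
  then have "Re (cn \<beta> \<alpha>) = 2 * Re (df \<beta> \<alpha>) / Re (df \<alpha> \<alpha>)"
    by (auto simp: cartan_number_def elim!: Reals_cases)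
  then have "Re (cn \<beta> \<alpha>) > 0" using pos root_norm_pos(1)[OF \<alpha>] by simp
  then have "c > 0" using c by simp
  then have "cn \<beta> \<alpha> = of_nat (nat c)" "1 \<le> nat c" using c by simp_all
  from string_down[OF \<alpha> roots_weights[OF \<beta>] this] have "(\<lambda>A. \<beta> A - \<alpha> A) \<in> weights" by simp
  moreover have "(\<lambda>A. \<beta> A - \<alpha> A) \<noteq> (\<lambda>_. 0)" using ne by (auto simp: fun_eq_iff)
  ultimately show ?thesis by (simp add: weights_0_roots)
qed

section \<open>Simple roots\<close>

abbreviation pos :: "('g \<Rightarrow> complex) \<Rightarrow> bool" where
  "pos f \<equiv> lex_less vs (\<lambda>_. 0) f"

abbreviation P :: "('g \<Rightarrow> complex) set" where
  "P \<equiv> positive_roots t vs"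

definition real_dual :: "('g \<Rightarrow> complex) set" where
  "real_dual = {f \<in> D. \<forall>A\<in>tR. f A \<in> \<real>}"

definition lincomb :: "(('g \<Rightarrow> complex) \<Rightarrow> real) \<Rightarrow> ('g \<Rightarrow> complex) set \<Rightarrow> 'g \<Rightarrow> complex" where
  "lincomb c S = (\<lambda>A. \<Sum>\<gamma>\<in>S. of_real (c \<gamma>) * \<gamma> A)"

lemma roots_real_dual: "\<alpha> \<in> roots t \<Longrightarrow> \<alpha> \<in> real_dual"
  by (simp add: real_dual_def roots_D roots_weights weight_real)

lemma real_dual_D: "f \<in> real_dual \<Longrightarrow> f \<in> D"
  by (simp add: real_dual_def)

lemma real_dual_add: "f \<in> real_dual \<Longrightarrow> g \<in> real_dual \<Longrightarrow> (\<lambda>A. f A + of_real c * g A) \<in> real_dual"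
  by (simp add: real_dual_def dual_space_add)

lemma lincomb_real_dual: "S \<subseteq> real_dual \<Longrightarrow> lincomb c S \<in> real_dual"
proof (induction S rule: infinite_finite_induct)
  case (insert \<gamma> S)
  then have "lincomb c (insert \<gamma> S) = (\<lambda>A. lincomb c S A + of_real (c \<gamma>) * \<gamma> A)"
    by (simp add: lincomb_def add.commute)
  then show ?case using insert real_dual_add by auto
qed (simp_all add: lincomb_def real_dual_def dual_space_0)

lemma lex_pos_iff: "pos f \<longleftrightarrow> (\<exists>i<length vs. (\<forall>j<i. f (vs ! j) = 0) \<and> Re (f (vs ! i)) > 0)"
  by (auto simp: lex_less_def)

lemma pos_total:
  assumes f: "f \<in> real_dual" and ne: "f \<noteq> (\<lambda>_. 0)" shows "pos f \<or> pos (- f)"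
proof -
  have "\<exists>i<length vs. f (vs ! i) \<noteq> 0"
  proof (rule ccontr)
    assume "\<not> ?thesis"
    then have "f = (\<lambda>_. 0)"
      using f by (intro dual_eqI) (auto simp: real_dual_D dual_space_0 in_set_conv_nth)
    then show False using ne by simp
  qed
  then obtain i where i: "i < length vs \<and> f (vs ! i) \<noteq> 0" "\<forall>j<i. \<not> (j < length vs \<and> f (vs ! j) \<noteq> 0)"
    using exists_least_iff[of "\<lambda>i. i < length vs \<and> f (vs ! i) \<noteq> 0"] by auto
  then have "f (vs ! i) \<in> \<real>" using f by (auto simp: real_dual_def vs_tR)
  then have "Re (f (vs ! i)) \<noteq> 0" using i by (auto simp: complex_is_Real_iff complex_eq_iff)
  then have "Re (f (vs ! i)) > 0 \<or> Re (f (vs ! i)) < 0" by linarith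
  then show ?thesis using i unfolding lex_pos_iff by (auto intro!: exI[of _ i])
qed

lemma pos_add: assumes "pos f" "pos g" shows "pos (\<lambda>A. f A + g A)"
proof -
  obtain i where i: "i < length vs" "\<forall>j<i. f (vs ! j) = 0" "Re (f (vs ! i)) > 0"
    using assms(1) by (auto simp: lex_pos_iff)
  obtain i' where i': "i' < length vs" "\<forall>j<i'. g (vs ! j) = 0" "Re (g (vs ! i')) > 0"
    using assms(2) by (auto simp: lex_pos_iff)
  have "Re (f (vs ! min i i') + g (vs ! min i i')) > 0"
    using i i' by (cases i i' rule: linorder_cases) (auto simp: min_def)
  then show ?thesis using i i' unfolding lex_pos_iff by (intro exI[of _ "min i i'"]) auto
qed

lemma pos_scale: "pos f \<Longrightarrow> c > 0 \<Longrightarrow> pos (\<lambda>A. of_real c * f A)"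
  by (auto simp: lex_pos_iff)

lemma pos_nonzero: "\<not> pos (\<lambda>_. 0)"
  by (simp add: lex_pos_iff)

lemma pos_antisym: "pos f \<Longrightarrow> \<not> pos (- f)"
  using pos_add[of f "- f"] pos_nonzero by auto

lemma vanish_on_a:
  assumes f: "f \<in> D" and v: "\<And>i. i < r \<Longrightarrow> f (vs ! i) = 0" and A: "A \<in> a" shows "f A = 0"
proof -
  have "R.subspace {x \<in> t. f x = 0}"
    using f subspace_t
    by (auto simp: R.subspace_def dual_0 dual_add dual_scale subspace_0 subspace_add subspace_scale)
  moreover have "set (take r vs) \<subseteq> {x \<in> t. f x = 0}"
  proof
    fix x assume "x \<in> set (take r vs)"
    then obtain i where "i < r" "i < length vs" "x = vs ! i" by (auto simp: in_set_conv_nth)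
    then show "x \<in> {x \<in> t. f x = 0}" using v by (simp add: vs_tR tR_t)
  qed
  ultimately have "R.span (set (take r vs)) \<subseteq> {x \<in> t. f x = 0}" by (intro R.span_minimal)
  then show ?thesis using A vs_span_a by auto
qed

text \<open>The first \<open>r\<close> of the vectors \<open>vs\<close> span \<open>a\<close>, so for a form that does not vanish on \<open>a\<close> the sign is
  decided there.\<close>

lemma pos_by_restriction:
  assumes f: "f \<in> D" "pos f" "\<exists>A\<in>a. f A \<noteq> 0" and eq: "\<And>A. A \<in> a \<Longrightarrow> g A = f A"
  shows "pos g"
proof -
  obtain i where i: "i < length vs" "\<forall>j<i. f (vs ! j) = 0" "Re (f (vs ! i)) > 0"
    using f(2) by (auto simp: lex_pos_iff)
  have "i < r"
  proof (rule ccontr)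
    assume "\<not> i < r"
    then show False using vanish_on_a[OF f(1)] f(3) i(2) by force
  qed
  have "g (vs ! j) = f (vs ! j)" if "j \<le> i" for j
  proof (rule eq)
    have "vs ! j \<in> set (take r vs)"
      using that \<open>i < r\<close> r_le by (auto simp: in_set_conv_nth intro!: exI[of _ j])
    then show "vs ! j \<in> a" using R.span_base vs_span_a by blast
  qed
  then show ?thesis using i unfolding lex_pos_iff by (intro exI[of _ i]) auto
qed

lemma pos_lincomb:
  assumes fin: "finite S" and S: "\<And>\<gamma>. \<gamma> \<in> S \<Longrightarrow> pos (f \<gamma>)" and c: "\<And>\<gamma>. \<gamma> \<in> S \<Longrightarrow> c \<gamma> \<ge> 0"
  shows "(\<forall>\<gamma>\<in>S. c \<gamma> = 0) \<or> pos (\<lambda>A. \<Sum>\<gamma>\<in>S. of_real (c \<gamma>) * f \<gamma> A)"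
  using assms
proof (induction S)
  case (insert \<gamma> S)
  show ?case
  proof (cases "c \<gamma> = 0")
    case True
    then show ?thesis using insert by simp
  next
    case False
    then have 1: "pos (\<lambda>A. of_real (c \<gamma>) * f \<gamma> A)"
      using insert.prems(1)[of \<gamma>] insert.prems(2)[of \<gamma>] by (intro pos_scale) auto
    have IH: "(\<forall>\<gamma>\<in>S. c \<gamma> = 0) \<or> pos (\<lambda>A. \<Sum>\<gamma>\<in>S. of_real (c \<gamma>) * f \<gamma> A)"
      using insert by auto
    then show ?thesis
    proof
      assume "\<forall>\<gamma>\<in>S. c \<gamma> = 0"
      then have "(\<lambda>A. \<Sum>\<gamma>\<in>insert \<gamma> S. of_real (c \<gamma>) * f \<gamma> A) = (\<lambda>A. of_real (c \<gamma>) * f \<gamma> A)"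
        using insert.hyps by simp
      then show ?thesis using 1 by simp
    next
      assume "pos (\<lambda>A. \<Sum>\<gamma>\<in>S. of_real (c \<gamma>) * f \<gamma> A)"
      from pos_add[OF 1 this] show ?thesis using insert.hyps by simp
    qed
  qed
qed simp

lemma P_iff: "\<alpha> \<in> P \<longleftrightarrow> \<alpha> \<in> roots t \<and> pos \<alpha>"
  by (simp add: positive_roots_def)

lemma finite_roots: "finite (roots t)"
  using finite_weights by (simp add: weights_0_roots)

lemma finite_P: "finite P"
  using finite_roots by (simp add: positive_roots_def)

lemma Pi_P: "\<alpha> \<in> Pi_roots \<Longrightarrow> \<alpha> \<in> P"
  by (simp add: Pi_roots_def simple_roots_def)

lemma Pi_roots: "\<alpha> \<in> Pi_roots \<Longrightarrow> \<alpha> \<in> roots t" and Pi_pos: "\<alpha> \<in> Pi_roots \<Longrightarrow> pos \<alpha>"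
  using Pi_P[of \<alpha>] by (auto simp: P_iff)

lemma Pi_indecomposable: "\<alpha> \<in> Pi_roots \<Longrightarrow> \<beta> \<in> P \<Longrightarrow> \<gamma> \<in> P \<Longrightarrow> \<alpha> \<noteq> (\<lambda>A. \<beta> A + \<gamma> A)"
  by (auto simp: Pi_roots_def simple_roots_def)

lemma finite_Pi: "finite Pi_roots"
  by (rule finite_subset[OF _ finite_P]) (auto simp: Pi_P)

text \<open>A positive root that is not simple is a sum of two positive roots, and each of them has fewer
  positive roots below it.\<close>

lemma positive_root_simple_combination:
  "\<beta> \<in> P \<Longrightarrow> \<exists>n :: _ \<Rightarrow> nat. \<beta> = lincomb (\<lambda>\<gamma>. of_nat (n \<gamma>)) Pi_roots"
proof (induction "card {\<gamma> \<in> P. pos (\<lambda>A. \<beta> A - \<gamma> A)}" arbitrary: \<beta> rule: less_induct)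
  case less
  show ?case
  proof (cases "\<beta> \<in> Pi_roots")
    case True
    then have "lincomb (\<lambda>\<gamma>. of_nat (if \<gamma> = \<beta> then 1 else 0)) Pi_roots = \<beta>"
      using finite_Pi by (simp add: lincomb_def if_distrib[of of_nat] if_distrib[of of_real] if_distrib[of "\<lambda>x. x * _"] cong: if_cong)
    then show ?thesis by metis
  next
    case False
    then obtain \<gamma> \<delta> where d: "\<gamma> \<in> P" "\<delta> \<in> P" "\<beta> = (\<lambda>A. \<gamma> A + \<delta> A)"
      using less.prems by (auto simp: Pi_roots_def simple_roots_def)
    have smaller: "\<exists>n :: _ \<Rightarrow> nat. \<gamma> = lincomb (\<lambda>\<gamma>. of_nat (n \<gamma>)) Pi_roots"
      if d: "\<gamma> \<in> P" "pos \<delta>" "\<And>A. \<beta> A = \<gamma> A + \<delta> A" for \<gamma> \<delta>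
    proof (rule less.hyps[OF _ d(1)], rule psubset_card_mono)
      have "pos (\<lambda>A. \<beta> A - \<epsilon> A)" if "pos (\<lambda>A. \<gamma> A - \<epsilon> A)" for \<epsilon>
        using pos_add[OF that d(2)] by (simp add: d(3) algebra_simps)
      moreover have "\<gamma> \<in> {\<gamma> \<in> P. pos (\<lambda>A. \<beta> A - \<gamma> A)}" "\<gamma> \<notin> {\<epsilon> \<in> P. pos (\<lambda>A. \<gamma> A - \<epsilon> A)}"
        using d pos_nonzero by auto
      ultimately show "{\<epsilon> \<in> P. pos (\<lambda>A. \<gamma> A - \<epsilon> A)} \<subset> {\<gamma> \<in> P. pos (\<lambda>A. \<beta> A - \<gamma> A)}" by blast
    qed (simp add: finite_P)
    obtain n :: "_ \<Rightarrow> nat" where n: "\<gamma> = lincomb (\<lambda>\<gamma>. of_nat (n \<gamma>)) Pi_roots"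
      using smaller[of \<gamma> \<delta>] d by (auto simp: P_iff)
    obtain m :: "_ \<Rightarrow> nat" where m: "\<delta> = lincomb (\<lambda>\<gamma>. of_nat (m \<gamma>)) Pi_roots"
      using smaller[of \<delta> \<gamma>] d by (auto simp: P_iff add.commute)
    have "\<beta> = lincomb (\<lambda>\<gamma>. of_nat (n \<gamma> + m \<gamma>)) Pi_roots"
      unfolding d(3) by (subst n, subst m) (simp add: lincomb_def sum.distrib distrib_right)
    then show ?thesis by (intro exI[of _ "\<lambda>\<gamma>. n \<gamma> + m \<gamma>"])
  qed
qed

text \<open>Otherwise the difference would be a root, and one of the two simple roots would be the sum of the
  other one and a positive root.\<close>

lemma simple_roots_obtuse:
  assumes \<alpha>: "\<alpha> \<in> Pi_roots" and \<beta>: "\<beta> \<in> Pi_roots" and ne: "\<alpha> \<noteq> \<beta>"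
  shows "Re (df \<alpha> \<beta>) \<le> 0"
proof (rule ccontr)
  assume "\<not> ?thesis"
  then have d: "(\<lambda>A. \<alpha> A - \<beta> A) \<in> roots t"
    using ne by (intro root_diff Pi_roots assms) auto
  then have "pos (\<lambda>A. \<alpha> A - \<beta> A) \<or> pos (- (\<lambda>A. \<alpha> A - \<beta> A))"
    by (intro pos_total roots_real_dual) (auto simp: weights_0_roots)
  then show False
  proof
    assume "pos (\<lambda>A. \<alpha> A - \<beta> A)"
    then show False using Pi_indecomposable[OF \<alpha>, of \<beta> "\<lambda>A. \<alpha> A - \<beta> A"] Pi_P[OF \<beta>] d by (simp add: P_iff)
  next
    assume p: "pos (- (\<lambda>A. \<alpha> A - \<beta> A))"
    have "(- (\<lambda>A. \<alpha> A - \<beta> A)) \<in> P" using p uminus_root[OF d] by (simp add: P_iff)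
    from Pi_indecomposable[OF \<beta> Pi_P[OF \<alpha>] this] show False by simp
  qed
qed

lemma dual_form_lincomb:
  assumes "S \<subseteq> real_dual" "g \<in> D" shows "df (lincomb c S) g = (\<Sum>\<gamma>\<in>S. of_real (c \<gamma>) * df \<gamma> g)"
proof -
  have "df (lincomb c S) g = lincomb c S (dv g)" by (rule dual_form_eval[OF real_dual_D[OF lincomb_real_dual[OF assms(1)]] assms(2)])
  also have "\<dots> = (\<Sum>\<gamma>\<in>S. of_real (c \<gamma>) * df \<gamma> g)"
    unfolding lincomb_def by (rule sum.cong[OF refl]) (use assms in \<open>auto simp: dual_form_eval real_dual_D\<close>)
  finally show ?thesis .
qed

lemma Pi_real_dual: "Pi_roots \<subseteq> real_dual"
  using Pi_roots roots_real_dual by auto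

text \<open>Vectors in an open half space at mutually obtuse angles are independent: the positive and the
  negative part of a linear relation coincide and have a nonpositive scalar product, hence vanish,
  which is absurd for a nontrivial nonnegative combination of positive forms.\<close>

lemma simple_roots_independent:
  assumes 0: "lincomb c Pi_roots = (\<lambda>_. 0)" and \<alpha>: "\<alpha> \<in> Pi_roots"
  shows "c \<alpha> = 0"
proof -
  \<comment> \<open>\<open>u\<close> and \<open>m\<close> are the positive and the negative part of \<open>c\<close>, with disjoint supports.\<close>
  define u where "u \<gamma> = max (c \<gamma>) 0" for \<gamma>
  define m where "m \<gamma> = max (- c \<gamma>) 0" for \<gamma>
  have um: "u \<gamma> - m \<gamma> = c \<gamma>" "u \<gamma> * m \<gamma> = 0" "u \<gamma> \<ge> 0" "m \<gamma> \<ge> 0" for \<gamma>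
    by (auto simp: u_def m_def max_def)
  have "lincomb u Pi_roots A - lincomb m Pi_roots A = lincomb c Pi_roots A" for A
    by (simp add: lincomb_def um(1)[symmetric] sum_subtractf left_diff_distrib)
  then have eq: "lincomb u Pi_roots = lincomb m Pi_roots" using 0 by auto
  let ?v = "lincomb u Pi_roots"
  have v: "?v \<in> real_dual" by (rule lincomb_real_dual[OF Pi_real_dual])
  have "df ?v ?v = df (lincomb u Pi_roots) (lincomb m Pi_roots)" using eq by simp
  also have "\<dots> = (\<Sum>\<gamma>\<in>Pi_roots. of_real (u \<gamma>) * df (lincomb m Pi_roots) \<gamma>)"
    by (subst dual_form_lincomb[OF Pi_real_dual]) (simp_all add: dual_form_sym real_dual_D lincomb_real_dual[OF Pi_real_dual])
  also have "\<dots> = (\<Sum>\<gamma>\<in>Pi_roots. \<Sum>\<delta>\<in>Pi_roots. of_real (u \<gamma> * m \<delta>) * df \<delta> \<gamma>)"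
    by (intro sum.cong refl, subst dual_form_lincomb[OF Pi_real_dual])
      (simp_all add: sum_distrib_left mult.assoc roots_D Pi_roots)
  finally have "Re (df ?v ?v) = (\<Sum>\<gamma>\<in>Pi_roots. \<Sum>\<delta>\<in>Pi_roots. (u \<gamma> * m \<delta>) * Re (df \<delta> \<gamma>))"
    by simp
  also have "\<dots> \<le> 0"
  proof (intro sum_nonpos)
    fix \<gamma> \<delta> assume "\<gamma> \<in> Pi_roots" "\<delta> \<in> Pi_roots"
    then have "\<gamma> \<noteq> \<delta> \<Longrightarrow> Re (df \<delta> \<gamma>) \<le> 0" by (simp add: simple_roots_obtuse)
    moreover have "u \<gamma> * m \<delta> \<ge> 0" using um(3,4) by simp
    ultimately show "(u \<gamma> * m \<delta>) * Re (df \<delta> \<gamma>) \<le> 0"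
      by (cases "\<gamma> = \<delta>") (simp add: um(2) del: mult_eq_0_iff, blast intro: mult_nonneg_nonpos)
  qed
  finally have v0: "?v = (\<lambda>_. 0)"
    using dual_form_pos[of ?v] v by (auto simp: real_dual_def)
  have "\<forall>\<gamma>\<in>Pi_roots. u \<gamma> = 0"
    using pos_lincomb[of Pi_roots "\<lambda>\<gamma>. \<gamma>" u, OF finite_Pi Pi_pos um(3)] v0 pos_nonzero by (auto simp: lincomb_def)
  moreover have "lincomb m Pi_roots = (\<lambda>_. 0)" using v0 unfolding eq .
  then have "\<forall>\<gamma>\<in>Pi_roots. m \<gamma> = 0"
    using pos_lincomb[of Pi_roots "\<lambda>\<gamma>. \<gamma>" m, OF finite_Pi Pi_pos um(4)] pos_nonzero by (auto simp: lincomb_def)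
  ultimately show ?thesis using um(1)[of \<alpha>] \<alpha> by simp
qed

lemma simple_coefficients_unique:
  assumes "lincomb c Pi_roots = lincomb d Pi_roots" "\<alpha> \<in> Pi_roots"
  shows "c \<alpha> = d \<alpha>"
proof -
  have "lincomb (\<lambda>\<gamma>. c \<gamma> - d \<gamma>) Pi_roots = (\<lambda>_. 0)"
    using assms(1) by (auto simp: lincomb_def sum_subtractf left_diff_distrib fun_eq_iff)
  from simple_roots_independent[OF this assms(2)] show ?thesis by simp
qed

lemma lincomb_single: "finite S \<Longrightarrow> \<beta> \<in> S \<Longrightarrow> lincomb (\<lambda>\<gamma>. if \<gamma> = \<beta> then x else 0) S = (\<lambda>A. of_real x * \<beta> A)"
  by (simp add: lincomb_def if_distrib[of of_real] if_distrib[of "\<lambda>x. x * _"] cong: if_cong)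

section \<open>Reflections and the longest element\<close>

abbreviation rf :: "('g \<Rightarrow> complex) \<Rightarrow> ('g \<Rightarrow> complex) \<Rightarrow> 'g \<Rightarrow> complex" where
  "rf \<equiv> root_reflection t"

abbreviation G :: "(('g \<Rightarrow> complex) \<Rightarrow> 'g \<Rightarrow> complex) monoid" where
  "G \<equiv> BijGroup D"

lemma rf_eq: "f \<in> D \<Longrightarrow> rf \<alpha> f = (\<lambda>A. f A - cn f \<alpha> * \<alpha> A)"
  by (simp add: root_reflection_def)

lemma rf_D: "\<alpha> \<in> D \<Longrightarrow> f \<in> D \<Longrightarrow> rf \<alpha> f \<in> D"
  by (simp add: rf_eq dual_space_diff)

lemma cn_add: "\<alpha> \<in> D \<Longrightarrow> f \<in> D \<Longrightarrow> g \<in> D \<Longrightarrow> cn (\<lambda>A. f A + c * g A) \<alpha> = cn f \<alpha> + c * cn g \<alpha>"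
  by (simp add: cartan_number_def dual_form_add algebra_simps add_divide_distrib)

lemma cn_self: "\<alpha> \<in> roots t \<Longrightarrow> cn \<alpha> \<alpha> = 2"
  by (simp add: cartan_number_def root_norm_pos)

lemma rf_add: "\<alpha> \<in> D \<Longrightarrow> f \<in> D \<Longrightarrow> g \<in> D \<Longrightarrow>
  rf \<alpha> (\<lambda>A. f A + c * g A) = (\<lambda>A. rf \<alpha> f A + c * rf \<alpha> g A)"
  by (simp add: rf_eq dual_space_add cn_add algebra_simps fun_eq_iff)

lemma rf_rf: assumes "\<alpha> \<in> roots t" "f \<in> D" shows "rf \<alpha> (rf \<alpha> f) = f"
proof -
  have "cn (\<lambda>A. f A - cn f \<alpha> * \<alpha> A) \<alpha> = - cn f \<alpha>"
    using cn_add[of \<alpha> f \<alpha> "- cn f \<alpha>"] assms by (simp add: roots_D cn_self)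
  then show ?thesis
    using assms by (simp add: rf_eq dual_space_diff roots_D)
qed

lemma rf_root: assumes "\<alpha> \<in> roots t" "\<beta> \<in> roots t" shows "rf \<alpha> \<beta> \<in> roots t"
proof -
  have "rf \<alpha> \<beta> \<in> weights"
    using assms by (simp add: rf_eq roots_D reflection_weight roots_weights)
  moreover have "rf \<alpha> \<beta> \<noteq> (\<lambda>_. 0)"
  proof
    assume "rf \<alpha> \<beta> = (\<lambda>_. 0)"
    then have "\<beta> = rf \<alpha> (\<lambda>_. 0)" using rf_rf[of \<alpha> \<beta>] assms by (simp add: roots_D)
    also have "\<dots> = (\<lambda>_. 0)"
      using dual_form_eval[OF dual_space_0 roots_D[OF assms(1)]]
      by (simp add: rf_eq dual_space_0 cartan_number_def)
    finally show False using assms by (simp add: weights_0_roots)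
  qed
  ultimately show ?thesis by (simp add: weights_0_roots)
qed

lemma rf_isometry: assumes "\<alpha> \<in> roots t" "f \<in> D" "g \<in> D" shows "df (rf \<alpha> f) (rf \<alpha> g) = df f g"
proof -
  have aD: "\<alpha> \<in> D" using assms by (simp add: roots_D)
  have l: "df (rf \<alpha> f) k = df f k - cn f \<alpha> * df \<alpha> k" if "k \<in> D" "f \<in> D" for k f
    using dual_form_add[OF that(2) aD that(1), of "- cn f \<alpha>"] that by (simp add: rf_eq)
  have r: "df k (rf \<alpha> g) = df k g - cn g \<alpha> * df k \<alpha>" if "k \<in> D" for k
    using l[OF that assms(3)] by (simp add: dual_form_sym)
  have "df (rf \<alpha> f) (rf \<alpha> g) = df f g - cn g \<alpha> * df f \<alpha> - cn f \<alpha> * (df \<alpha> g - cn g \<alpha> * df \<alpha> \<alpha>)"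
    using assms aD by (simp add: l r rf_D) (simp add: algebra_simps)
  moreover have "cn g \<alpha> * df \<alpha> \<alpha> = 2 * df g \<alpha>" "cn f \<alpha> * df \<alpha> \<alpha> = 2 * df f \<alpha>" for g
    using root_norm_pos(2)[OF assms(1)] by (simp_all add: cartan_number_def)
  moreover have "cn g \<alpha> * df f \<alpha> = cn f \<alpha> * df g \<alpha>" by (simp add: cartan_number_def)
  ultimately show ?thesis using dual_form_sym[of \<alpha> g] by (simp add: algebra_simps)
qed

lemma rf_Bij: assumes "\<alpha> \<in> roots t" shows "rf \<alpha> \<in> Bij D"
proof -
  have "bij_betw (rf \<alpha>) D D"
    by (rule bij_betwI[of _ _ _ "rf \<alpha>"]) (use assms in \<open>auto simp: rf_D roots_D rf_rf\<close>)
  then show ?thesis by (simp add: Bij_def root_reflection_def)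
qed

text \<open>The products that define \<open>word_length\<close>.\<close>

definition word :: "('g \<Rightarrow> complex) list \<Rightarrow> ('g \<Rightarrow> complex) \<Rightarrow> 'g \<Rightarrow> complex" where
  "word \<alpha>s = foldr (\<lambda>\<alpha> u. rf \<alpha> \<otimes>\<^bsub>G\<^esub> u) \<alpha>s \<one>\<^bsub>G\<^esub>"

lemma word_Bij: "set \<alpha>s \<subseteq> roots t \<Longrightarrow> word \<alpha>s \<in> Bij D"
proof (induction \<alpha>s)
  case Nil
  show ?case using id_Bij[of D] by (simp add: word_def BijGroup_def restrict_def)
next
  case (Cons \<alpha> \<alpha>s)
  then show ?case by (simp add: word_def BijGroup_def rf_Bij compose_Bij)
qed

lemma word_D: "set \<alpha>s \<subseteq> roots t \<Longrightarrow> f \<in> D \<Longrightarrow> word \<alpha>s f \<in> D"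
  using word_Bij Bij_imp_funcset by blast

lemma word_Nil: "f \<in> D \<Longrightarrow> word [] f = f"
  by (simp add: word_def BijGroup_def)

lemma word_Cons: "\<alpha> \<in> roots t \<Longrightarrow> set \<alpha>s \<subseteq> roots t \<Longrightarrow> f \<in> D \<Longrightarrow> word (\<alpha> # \<alpha>s) f = rf \<alpha> (word \<alpha>s f)"
  using word_Bij[of \<alpha>s] rf_Bij[of \<alpha>] by (simp add: word_def BijGroup_def compose_def)

lemma word_append: "set \<alpha>s \<subseteq> roots t \<Longrightarrow> set \<beta>s \<subseteq> roots t \<Longrightarrow> word (\<alpha>s @ \<beta>s) = word \<alpha>s \<otimes>\<^bsub>G\<^esub> word \<beta>s"
proof (induction \<alpha>s)
  case Nil
  interpret group G by (rule group_BijGroup)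
  have "word \<beta>s \<in> carrier G" using Nil word_Bij by (simp add: BijGroup_def)
  then show ?case by (simp add: word_def)
next
  case (Cons \<alpha> \<alpha>s)
  interpret group G by (rule group_BijGroup)
  have "word \<alpha>s \<in> carrier G" "word \<beta>s \<in> carrier G" "rf \<alpha> \<in> carrier G"
    using Cons word_Bij rf_Bij by (simp_all add: BijGroup_def)
  then show ?case using Cons m_assoc by (simp add: word_def)
qed

lemma reflection_group_word:
  assumes J: "J \<subseteq> roots t" and w: "w \<in> reflection_group t J"
  shows "\<exists>\<alpha>s. set \<alpha>s \<subseteq> J \<and> w = word \<alpha>s"
  using w unfolding reflection_group_def
proof (induction rule: generate.induct)
  case one
  show ?case by (intro exI[of _ "[]"]) (simp add: word_def)
next
  case (incl x)
  then obtain \<alpha> where \<alpha>: "\<alpha> \<in> J" "x = rf \<alpha>" by auto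
  interpret group G by (rule group_BijGroup)
  have "rf \<alpha> \<in> carrier G" using \<alpha> J rf_Bij by (auto simp: BijGroup_def)
  then show ?case using \<alpha> by (intro exI[of _ "[\<alpha>]"]) (simp add: word_def)
next
  case (inv x)
  then obtain \<alpha> where \<alpha>: "\<alpha> \<in> J" "x = rf \<alpha>" by auto
  interpret group G by (rule group_BijGroup)
  have c: "rf \<alpha> \<in> carrier G" using \<alpha> J rf_Bij by (auto simp: BijGroup_def)
  have "rf \<alpha> \<otimes>\<^bsub>G\<^esub> rf \<alpha> = \<one>\<^bsub>G\<^esub>"
    using \<alpha> J rf_Bij[of \<alpha>] by (auto simp: BijGroup_def compose_def rf_rf subset_iff intro!: restrict_ext)
  then have "inv\<^bsub>G\<^esub> (rf \<alpha>) = rf \<alpha>" using c by (simp add: inv_equality)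
  then show ?case using \<alpha> c by (intro exI[of _ "[\<alpha>]"]) (simp add: word_def)
next
  case (eng x y)
  then obtain \<alpha>s \<beta>s where "set \<alpha>s \<subseteq> J" "x = word \<alpha>s" "set \<beta>s \<subseteq> J" "y = word \<beta>s" by auto
  then show ?case using J by (intro exI[of _ "\<alpha>s @ \<beta>s"]) (simp add: word_append)
qed

lemma word_reflection_group:
  "set \<alpha>s \<subseteq> J \<Longrightarrow> word \<alpha>s \<in> reflection_group t J"
  unfolding reflection_group_def
proof (induction \<alpha>s)
  case Nil
  then show ?case by (simp add: word_def generate.one)
next
  case (Cons \<alpha> \<alpha>s)
  then have "rf \<alpha> \<otimes>\<^bsub>G\<^esub> word \<alpha>s \<in> generate G (rf ` J)"
    by (intro generate.eng) (auto intro: generate.incl)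
  then show ?case by (simp add: word_def)
qed

lemma word_length_word:
  "word_length t J w = (LEAST n. \<exists>\<alpha>s. length \<alpha>s = n \<and> set \<alpha>s \<subseteq> J \<and> w = word \<alpha>s)"
  by (simp add: word_length_def word_def)

lemma word_length_le: "set \<alpha>s \<subseteq> J \<Longrightarrow> word_length t J (word \<alpha>s) \<le> length \<alpha>s"
  unfolding word_length_word by (intro Least_le) auto

lemma reduced_word:
  assumes "J \<subseteq> roots t" "w \<in> reflection_group t J"
  obtains \<alpha>s where "set \<alpha>s \<subseteq> J" "w = word \<alpha>s" "length \<alpha>s = word_length t J w"
proof -
  have "\<exists>n \<alpha>s. length \<alpha>s = n \<and> set \<alpha>s \<subseteq> J \<and> w = word \<alpha>s"
    using reflection_group_word[OF assms] by auto
  from LeastI_ex[OF this] show ?thesis unfolding word_length_word[symmetric] using that by blast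
qed

lemma word_root: "set \<alpha>s \<subseteq> roots t \<Longrightarrow> \<beta> \<in> roots t \<Longrightarrow> word \<alpha>s \<beta> \<in> roots t"
  by (induction \<alpha>s) (simp_all add: word_Nil word_Cons roots_D rf_root)

lemma word_isometry: "set \<alpha>s \<subseteq> roots t \<Longrightarrow> f \<in> D \<Longrightarrow> g \<in> D \<Longrightarrow> df (word \<alpha>s f) (word \<alpha>s g) = df f g"
  by (induction \<alpha>s) (simp_all add: word_Nil word_Cons word_D rf_isometry)

lemma word_add: "set \<alpha>s \<subseteq> roots t \<Longrightarrow> f \<in> D \<Longrightarrow> g \<in> D \<Longrightarrow>
  word \<alpha>s (\<lambda>A. f A + c * g A) = (\<lambda>A. word \<alpha>s f A + c * word \<alpha>s g A)"
  by (induction \<alpha>s) (simp_all add: word_Nil word_Cons word_D rf_add roots_D dual_space_add)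

lemma word_uminus: "set \<alpha>s \<subseteq> roots t \<Longrightarrow> f \<in> D \<Longrightarrow> word \<alpha>s (- f) = - word \<alpha>s f"
  \<comment> \<open>\<open>word_add\<close> expresses \<open>- f\<close> as \<open>f + (-2) * f\<close>.\<close>
  using word_add[of \<alpha>s f f "-2"] by (simp add: fun_Compl_def)

text \<open>Both \<open>\<beta>\<close> and the negative of its reflection have nonnegative coefficients in the simple roots, and
  their sum is a multiple of \<open>\<alpha>\<close>. Hence no other simple root occurs in \<open>\<beta>\<close>. Proportionality is all
  that the exchange argument asks for, since proportional roots have the same reflection.\<close>

lemma simple_reflection_negative:
  assumes \<alpha>: "\<alpha> \<in> Pi_roots" and \<beta>: "\<beta> \<in> P" and neg: "pos (- rf \<alpha> \<beta>)"
  shows "\<exists>c. c \<noteq> 0 \<and> \<beta> = (\<lambda>A. c * \<alpha> A)"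
proof -
  have bR: "\<beta> \<in> roots t" and aR: "\<alpha> \<in> roots t" using \<beta> Pi_roots[OF \<alpha>] by (simp_all add: P_iff)
  obtain n :: "_ \<Rightarrow> nat" where n: "\<beta> = lincomb (\<lambda>\<gamma>. of_nat (n \<gamma>)) Pi_roots"
    using positive_root_simple_combination[OF \<beta>] by blast
  have "- rf \<alpha> \<beta> \<in> P" using neg uminus_root[OF rf_root[OF aR bR]] by (simp add: P_iff)
  then obtain m :: "_ \<Rightarrow> nat" where m: "- rf \<alpha> \<beta> = lincomb (\<lambda>\<gamma>. of_nat (m \<gamma>)) Pi_roots"
    using positive_root_simple_combination by blast
  obtain x where x: "cn \<beta> \<alpha> = of_int x"
    using cartan_number_Ints[OF aR roots_weights[OF bR]] by (rule Ints_cases)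
  have "lincomb (\<lambda>\<gamma>. of_nat (n \<gamma>) + of_nat (m \<gamma>)) Pi_roots = lincomb (\<lambda>\<gamma>. if \<gamma> = \<alpha> then of_int x else 0) Pi_roots"
  proof
    fix A
    have "lincomb (\<lambda>\<gamma>. of_nat (n \<gamma>) + of_nat (m \<gamma>)) Pi_roots A =
        lincomb (\<lambda>\<gamma>. of_nat (n \<gamma>)) Pi_roots A + lincomb (\<lambda>\<gamma>. of_nat (m \<gamma>)) Pi_roots A"
      by (simp add: lincomb_def sum.distrib distrib_right)
    also have "\<dots> = of_int x * \<alpha> A"
      unfolding n[symmetric] m[symmetric] using bR by (simp add: rf_eq roots_D x)
    finally show "lincomb (\<lambda>\<gamma>. of_nat (n \<gamma>) + of_nat (m \<gamma>)) Pi_roots A = lincomb (\<lambda>\<gamma>. if \<gamma> = \<alpha> then of_int x else 0) Pi_roots A"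
      using \<alpha> by (simp add: lincomb_single finite_Pi)
  qed
  note unique = simple_coefficients_unique[OF this]
  have "n \<gamma> = 0" if "\<gamma> \<in> Pi_roots" "\<gamma> \<noteq> \<alpha>" for \<gamma>
    using unique[OF that(1)] that(2) by (simp add: of_nat_add[symmetric] del: of_nat_add)
  then have "lincomb (\<lambda>\<gamma>. of_nat (n \<gamma>)) Pi_roots = lincomb (\<lambda>\<gamma>. if \<gamma> = \<alpha> then of_nat (n \<alpha>) else 0) Pi_roots"
    by (auto simp: lincomb_def intro!: sum.cong)
  then have eq: "\<beta> = (\<lambda>A. of_nat (n \<alpha>) * \<alpha> A)" using n \<alpha> by (simp add: lincomb_single finite_Pi)
  have "n \<alpha> \<noteq> 0"
  proof
    assume "n \<alpha> = 0"
    then show False using eq bR by (simp add: weights_0_roots)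
  qed
  then show ?thesis using eq by (intro exI[of _ "of_nat (n \<alpha>)"]) auto
qed

lemma rf_multiple:
  assumes "\<alpha> \<in> roots t" "\<beta> \<in> D" "c \<noteq> 0" "\<beta> = (\<lambda>A. c * \<alpha> A)" "f \<in> D"
  shows "rf \<beta> f = rf \<alpha> f"
proof -
  have aD: "\<alpha> \<in> D" using assms by (simp add: roots_D)
  have l: "df \<beta> k = c * df \<alpha> k" if "k \<in> D" for k
    using that aD assms by (simp add: dual_form_eval)
  have "df f \<beta> = c * df f \<alpha>" "df \<beta> \<beta> = c * (c * df \<alpha> \<alpha>)"
    using l[OF assms(5)] l[OF assms(2)] l[OF aD] by (simp_all add: dual_form_sym)
  then have "cn f \<beta> * c = cn f \<alpha>"
    using assms(3) root_norm_pos(2)[OF assms(1)] by (simp add: cartan_number_def)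
  then have "cn f \<beta> * (c * \<alpha> A) = cn f \<alpha> * \<alpha> A" for A by (simp add: mult.assoc[symmetric])
  then have "cn f \<beta> * \<beta> A = cn f \<alpha> * \<alpha> A" for A using assms(4) by simp
  then show ?thesis using assms(5) by (simp add: rf_eq)
qed

lemma word_reflection:
  assumes "set \<alpha>s \<subseteq> roots t" "\<alpha> \<in> D" "f \<in> D"
  shows "word \<alpha>s (rf \<alpha> f) = rf (word \<alpha>s \<alpha>) (word \<alpha>s f)"
proof -
  have "word \<alpha>s (rf \<alpha> f) = (\<lambda>A. word \<alpha>s f A + - cn f \<alpha> * word \<alpha>s \<alpha> A)"
    using word_add[OF assms(1,3,2), of "- cn f \<alpha>"] assms by (simp add: rf_eq)
  then show ?thesis
    using assms by (simp add: rf_eq word_D cartan_number_def word_isometry)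
qed

text \<open>The exchange condition. Applying the letters of the word one after the other to \<open>\<alpha>\<close>, starting with
  the last one, leads from a positive to a negative root; at the letter \<open>\<delta>\<close> where the sign changes
  the root is a multiple of \<open>\<delta>\<close>. The reflection in \<open>\<alpha>\<close> is therefore conjugate to that in \<open>\<delta>\<close> by the
  letters to the right of \<open>\<delta>\<close>, and multiplying by it deletes \<open>\<delta>\<close> from the word.\<close>

lemma exchange:
  assumes "set \<alpha>s \<subseteq> Pi_roots" "\<alpha> \<in> Pi_roots" "pos (- word \<alpha>s \<alpha>)"
  shows "\<exists>\<beta>s. Suc (length \<beta>s) = length \<alpha>s \<and> set \<beta>s \<subseteq> set \<alpha>s \<and> (\<forall>f\<in>D. word \<beta>s f = word \<alpha>s (rf \<alpha> f))"
  using assms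
proof (induction \<alpha>s)
  case Nil
  then have "word [] \<alpha> = \<alpha>" by (simp add: word_Nil roots_D Pi_roots)
  then have "pos (- \<alpha>)" using Nil.prems(3) by (simp only:)
  then show ?case using pos_antisym[OF Pi_pos[OF Nil.prems(2)]] by blast
next
  case (Cons \<delta> \<alpha>s)
  have s: "set \<alpha>s \<subseteq> roots t" "\<delta> \<in> roots t" "\<alpha> \<in> roots t" using Cons.prems Pi_roots by auto
  have b: "word \<alpha>s \<alpha> \<in> roots t" by (rule word_root[OF s(1,3)])
  then have "pos (word \<alpha>s \<alpha>) \<or> pos (- word \<alpha>s \<alpha>)"
    by (intro pos_total roots_real_dual) (simp_all add: weights_0_roots)
  then show ?case
  proof
    assume "pos (- word \<alpha>s \<alpha>)"
    then obtain \<beta>s where \<beta>s: "Suc (length \<beta>s) = length \<alpha>s" "set \<beta>s \<subseteq> set \<alpha>s"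
      "\<forall>f\<in>D. word \<beta>s f = word \<alpha>s (rf \<alpha> f)"
      using Cons.IH Cons.prems(1,2) by (auto simp: fun_Compl_def)
    then have "\<forall>f\<in>D. word (\<delta> # \<beta>s) f = word (\<delta> # \<alpha>s) (rf \<alpha> f)"
      using s by (auto simp: word_Cons rf_D roots_D)
    then show ?thesis using \<beta>s by (intro exI[of _ "\<delta> # \<beta>s"]) auto
  next
    assume "pos (word \<alpha>s \<alpha>)"
    then have "word \<alpha>s \<alpha> \<in> P" using b by (simp add: P_iff)
    moreover have "pos (- rf \<delta> (word \<alpha>s \<alpha>))"
      using Cons.prems s by (simp add: word_Cons roots_D fun_Compl_def)
    ultimately obtain c where "c \<noteq> 0" "word \<alpha>s \<alpha> = (\<lambda>A. c * \<delta> A)"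
      using simple_reflection_negative[of \<delta> "word \<alpha>s \<alpha>"] Cons.prems by auto
    then have r: "rf (word \<alpha>s \<alpha>) f = rf \<delta> f" if "f \<in> D" for f
      using rf_multiple[OF s(2) roots_D[OF b]] that by blast
    have "word \<alpha>s f = word (\<delta> # \<alpha>s) (rf \<alpha> f)" if f: "f \<in> D" for f
    proof -
      have "word (\<delta> # \<alpha>s) (rf \<alpha> f) = rf \<delta> (word \<alpha>s (rf \<alpha> f))"
        using s f by (simp add: word_Cons rf_D roots_D)
      also have "\<dots> = rf \<delta> (rf \<delta> (word \<alpha>s f))"
        using s f by (simp add: word_reflection roots_D r word_D)
      finally show ?thesis using s f by (simp add: rf_rf word_D)
    qed
    then show ?thesis by (intro exI[of _ \<alpha>s]) auto
  qed
qed

text \<open>If \<open>w \<alpha>\<close> were positive, then \<open>u = w s\<^sub>\<alpha>\<close> would send \<open>\<alpha>\<close> to a negative root, and by the exchange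
  condition \<open>u s\<^sub>\<alpha> = w\<close> would be shorter than \<open>u\<close>.\<close>

lemma longest_element_negative:
  assumes J: "J \<subseteq> Pi_roots" and w: "longest_element t J w" and \<alpha>: "\<alpha> \<in> J"
  shows "pos (- w \<alpha>)"
proof (rule ccontr)
  assume n: "\<not> pos (- w \<alpha>)"
  have JR: "J \<subseteq> roots t" using J Pi_roots by auto
  have aR: "\<alpha> \<in> roots t" using JR \<alpha> by auto
  have wW: "w \<in> reflection_group t J" and max: "\<And>u. u \<in> reflection_group t J \<Longrightarrow> word_length t J u \<le> word_length t J w"
    using w by (auto simp: longest_element_def)
  obtain \<alpha>s where as: "set \<alpha>s \<subseteq> J" "w = word \<alpha>s" using reflection_group_word[OF JR wW] by auto
  have asR: "set \<alpha>s \<subseteq> roots t" using as JR by auto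
  let ?u = "word (\<alpha>s @ [\<alpha>])"
  have u: "?u f = w (rf \<alpha> f)" if "f \<in> D" for f
  proof -
    have "word [\<alpha>] f = rf \<alpha> f" using that aR by (simp add: word_Cons word_Nil)
    moreover have "word [\<alpha>] \<in> Bij D" using aR by (intro word_Bij) auto
    ultimately show ?thesis
      using that asR aR word_Bij[OF asR] by (simp add: word_append as BijGroup_def compose_def)
  qed
  have uW: "?u \<in> reflection_group t J" using as \<alpha> by (intro word_reflection_group) auto
  obtain \<beta>s where bs: "set \<beta>s \<subseteq> J" "?u = word \<beta>s" "length \<beta>s = word_length t J ?u"
    by (rule reduced_word[OF JR uW])
  have "rf \<alpha> \<alpha> = - \<alpha>" using aR by (simp add: rf_eq roots_D cn_self fun_eq_iff)
  then have "?u \<alpha> = - w \<alpha>" using u[of \<alpha>] aR asR by (simp add: roots_D word_uminus as)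
  moreover have "pos (w \<alpha>) \<or> pos (- w \<alpha>)" using word_root[OF asR aR] as
    by (intro pos_total roots_real_dual) (simp_all add: weights_0_roots)
  ultimately have "pos (- word \<beta>s \<alpha>)" using n bs by (simp add: fun_Compl_def)
  then obtain \<gamma>s where gs: "Suc (length \<gamma>s) = length \<beta>s" "set \<gamma>s \<subseteq> set \<beta>s"
      "\<forall>f\<in>D. word \<gamma>s f = word \<beta>s (rf \<alpha> f)"
    using exchange[of \<beta>s \<alpha>] bs J \<alpha> by blast
  have gsJ: "set \<gamma>s \<subseteq> J" using gs bs by auto
  have "word \<gamma>s = w"
  proof (rule extensionalityI[of _ D])
    show "word \<gamma>s \<in> extensional D" "w \<in> extensional D"
      unfolding as by (intro Bij_imp_extensional word_Bij order.trans[OF gsJ JR] asR)+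
    fix f assume f: "f \<in> D"
    have "word \<gamma>s f = ?u (rf \<alpha> f)" using gs(3) f bs by simp
    then show "word \<gamma>s f = w f" using f aR by (simp add: u rf_D roots_D rf_rf)
  qed
  then have "word_length t J w \<le> length \<gamma>s" using word_length_le[OF gsJ] by simp
  then show False using max[OF uW] gs(1) bs(3) by simp
qed

section \<open>The diagram automorphism\<close>

lemma Pi_bullet_Pi: "Pi_bullet \<subseteq> Pi_roots"
  by (auto simp: Pi_bullet_def)

lemma Pi_bullet_roots: "Pi_bullet \<subseteq> roots t"
  using Pi_bullet_Pi Pi_roots by auto

lemma finite_Pi_bullet: "finite Pi_bullet"
  using finite_subset[OF Pi_bullet_Pi finite_Pi] .

lemma Pi_bullet_a: "\<gamma> \<in> Pi_bullet \<Longrightarrow> A \<in> a \<Longrightarrow> \<gamma> A = 0"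
  by (simp add: Pi_bullet_def)

text \<open>Each reflection adds an integral multiple of a root in \<open>Pi_bullet\<close>, since Cartan numbers are
  integers.\<close>

lemma word_translation:
  assumes "set \<alpha>s \<subseteq> Pi_bullet" "\<beta> \<in> roots t"
  shows "\<exists>c :: _ \<Rightarrow> int. word \<alpha>s \<beta> = (\<lambda>A. \<beta> A - lincomb (\<lambda>\<gamma>. of_int (c \<gamma>)) Pi_bullet A)"
  using assms(1)
proof (induction \<alpha>s)
  case Nil
  show ?case using assms(2) by (intro exI[of _ "\<lambda>_. 0"]) (simp add: word_Nil roots_D lincomb_def)
next
  case (Cons \<alpha> \<alpha>s)
  then obtain c :: "_ \<Rightarrow> int" where c: "word \<alpha>s \<beta> = (\<lambda>A. \<beta> A - lincomb (\<lambda>\<gamma>. of_int (c \<gamma>)) Pi_bullet A)" by auto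
  have s: "set \<alpha>s \<subseteq> roots t" "\<alpha> \<in> roots t" "\<alpha> \<in> Pi_bullet" using Cons.prems Pi_bullet_roots by auto
  obtain x where x: "cn (word \<alpha>s \<beta>) \<alpha> = of_int x"
    using cartan_number_Ints[OF s(2) roots_weights[OF word_root[OF s(1) assms(2)]]] by (rule Ints_cases)
  have "lincomb (\<lambda>\<gamma>. of_int (c \<gamma> + (if \<gamma> = \<alpha> then x else 0))) Pi_bullet A =
      lincomb (\<lambda>\<gamma>. of_int (c \<gamma>)) Pi_bullet A + lincomb (\<lambda>\<gamma>. if \<gamma> = \<alpha> then of_int x else 0) Pi_bullet A" for A
    unfolding lincomb_def sum.distrib[symmetric] by (intro sum.cong) (auto simp: distrib_right)
  then have e: "lincomb (\<lambda>\<gamma>. of_int (c \<gamma> + (if \<gamma> = \<alpha> then x else 0))) Pi_bullet A =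
      lincomb (\<lambda>\<gamma>. of_int (c \<gamma>)) Pi_bullet A + of_int x * \<alpha> A" for A
    using s(3) by (simp add: lincomb_single finite_Pi_bullet)
  have "word (\<alpha> # \<alpha>s) \<beta> = rf \<alpha> (word \<alpha>s \<beta>)"
    using s assms by (simp add: word_Cons roots_D)
  also have "\<dots> = (\<lambda>A. word \<alpha>s \<beta> A - of_int x * \<alpha> A)"
    using s assms by (simp add: rf_eq word_D roots_D x)
  also have "\<dots> = (\<lambda>A. \<beta> A - lincomb (\<lambda>\<gamma>. of_int (c \<gamma> + (if \<gamma> = \<alpha> then x else 0))) Pi_bullet A)"
    by (simp only: e) (simp add: c algebra_simps)
  finally show ?case by (intro exI[of _ "\<lambda>\<gamma>. c \<gamma> + (if \<gamma> = \<alpha> then x else 0)"])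
qed

lemma word_restriction:
  assumes "set \<alpha>s \<subseteq> Pi_bullet" "\<beta> \<in> roots t" "A \<in> a"
  shows "word \<alpha>s \<beta> A = \<beta> A"
proof -
  obtain c :: "_ \<Rightarrow> int" where c: "word \<alpha>s \<beta> = (\<lambda>A. \<beta> A - lincomb (\<lambda>\<gamma>. of_int (c \<gamma>)) Pi_bullet A)"
    using word_translation[OF assms(1,2)] by auto
  then show ?thesis using assms(3) by (simp add: lincomb_def Pi_bullet_a)
qed

lemma word_lincomb:
  assumes \<alpha>s: "set \<alpha>s \<subseteq> roots t" and fin: "finite S" and S: "S \<subseteq> real_dual"
  shows "word \<alpha>s (lincomb c S) = (\<lambda>A. \<Sum>\<gamma>\<in>S. of_real (c \<gamma>) * word \<alpha>s \<gamma> A)"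
  using fin S
proof (induction S)
  case empty
  have "word \<alpha>s (\<lambda>_. 0) = (\<lambda>_. 0)"
    using word_add[OF \<alpha>s dual_space_0 dual_space_0, of "-1"] by simp
  then show ?case by (simp add: lincomb_def)
next
  case (insert \<gamma> S)
  have "lincomb c (insert \<gamma> S) = (\<lambda>A. lincomb c S A + of_real (c \<gamma>) * \<gamma> A)"
    using insert.hyps by (simp add: lincomb_def add.commute)
  then have "word \<alpha>s (lincomb c (insert \<gamma> S)) = (\<lambda>A. word \<alpha>s (lincomb c S) A + of_real (c \<gamma>) * word \<alpha>s \<gamma> A)"
    using insert.prems word_add[OF \<alpha>s, of "lincomb c S" \<gamma>] by (simp add: real_dual_D lincomb_real_dual)
  then show ?case using insert by (simp add: add.commute)
qed

text \<open>If a simple root \<open>\<gamma>\<close> outside \<open>Pi_bullet\<close> occurred, its multiple would agree on \<open>a\<close> with the negative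
  of the other terms. As the sign of a form that does not vanish on \<open>a\<close> is decided by its restriction
  to \<open>a\<close>, this negative would be positive.\<close>

lemma vanishing_positive_root:
  assumes \<beta>: "\<beta> \<in> P" and van: "\<And>A. A \<in> a \<Longrightarrow> \<beta> A = 0"
  shows "\<exists>n :: _ \<Rightarrow> nat. \<beta> = lincomb (\<lambda>\<gamma>. of_nat (n \<gamma>)) Pi_bullet"
proof -
  obtain n :: "_ \<Rightarrow> nat" where n: "\<beta> = lincomb (\<lambda>\<gamma>. of_nat (n \<gamma>)) Pi_roots"
    using positive_root_simple_combination[OF \<beta>] by blast
  have "n \<gamma> = 0" if \<gamma>: "\<gamma> \<in> Pi_roots" "\<gamma> \<notin> Pi_bullet" for \<gamma>
  proof (rule ccontr)
    assume n0: "n \<gamma> \<noteq> 0"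
    let ?f = "\<lambda>A. of_real (of_nat (n \<gamma>)) * \<gamma> A"
    let ?g = "\<lambda>A. \<Sum>\<delta>\<in>Pi_roots - {\<gamma>}. of_real (of_nat (n \<delta>)) * \<delta> A"
    have split: "\<beta> A = ?f A + ?g A" for A
      by (subst n) (simp add: lincomb_def sum.remove[OF finite_Pi \<gamma>(1)])
    have "pos ?f" using n0 Pi_pos[OF \<gamma>(1)] by (intro pos_scale) auto
    moreover have "?f \<in> D" using roots_D[OF Pi_roots[OF \<gamma>(1)]] dual_space_add[OF dual_space_0] by force
    moreover have "\<exists>A\<in>a. ?f A \<noteq> 0" using n0 \<gamma> by (auto simp: Pi_bullet_def)
    moreover have "(- ?g) A = ?f A" if "A \<in> a" for A
      using van[OF that] split[of A] by (simp add: neg_eq_iff_add_eq_0 add.commute)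
    ultimately have neg: "pos (- ?g)" by (intro pos_by_restriction[of ?f "- ?g"])
    have "(\<forall>\<delta>\<in>Pi_roots - {\<gamma>}. real (n \<delta>) = 0) \<or> pos ?g"
      using finite_Pi by (intro pos_lincomb) (auto simp: Pi_pos)
    then show False
    proof
      assume "\<forall>\<delta>\<in>Pi_roots - {\<gamma>}. real (n \<delta>) = 0"
      then have "- ?g = (\<lambda>_. 0)" by (simp add: fun_Compl_def)
      then show False using neg pos_nonzero by (simp only:)
    next
      assume "pos ?g"
      then show False using neg pos_antisym by blast
    qed
  qed
  then have "\<beta> = lincomb (\<lambda>\<gamma>. of_nat (n \<gamma>)) Pi_bullet"
    unfolding n lincomb_def using finite_Pi Pi_bullet_Pi by (intro ext sum.mono_neutral_right) auto
  then show ?thesis by blast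
qed

lemma longest_element_bullet_negative:
  assumes w: "longest_element t Pi_bullet w" and \<beta>: "\<beta> \<in> P" and van: "\<And>A. A \<in> a \<Longrightarrow> \<beta> A = 0"
  shows "pos (- w \<beta>)"
proof -
  obtain \<alpha>s where as: "set \<alpha>s \<subseteq> Pi_bullet" "w = word \<alpha>s"
    using reflection_group_word[OF Pi_bullet_roots] w by (auto simp: longest_element_def)
  obtain n :: "_ \<Rightarrow> nat" where n: "\<beta> = lincomb (\<lambda>\<gamma>. of_nat (n \<gamma>)) Pi_bullet"
    using vanishing_positive_root[OF \<beta> van] by blast
  have "w \<beta> = (\<lambda>A. \<Sum>\<gamma>\<in>Pi_bullet. of_real (of_nat (n \<gamma>)) * w \<gamma> A)"
    unfolding as by (subst n) (rule word_lincomb, use as Pi_bullet_roots finite_Pi_bullet roots_real_dual in auto)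
  then have eq: "- w \<beta> = (\<lambda>A. \<Sum>\<gamma>\<in>Pi_bullet. of_real (of_nat (n \<gamma>)) * (- w \<gamma>) A)"
    by (simp add: fun_Compl_def sum_negf)
  have "(\<forall>\<gamma>\<in>Pi_bullet. real (n \<gamma>) = 0) \<or> pos (- w \<beta>)"
    unfolding eq using finite_Pi_bullet longest_element_negative[OF Pi_bullet_Pi w]
    by (intro pos_lincomb) (auto simp: fun_Compl_def)
  moreover have "\<not> (\<forall>\<gamma>\<in>Pi_bullet. real (n \<gamma>) = 0)"
  proof
    assume "\<forall>\<gamma>\<in>Pi_bullet. real (n \<gamma>) = 0"
    then have "\<beta> = (\<lambda>_. 0)" unfolding n by (simp add: lincomb_def)
    then show False using \<beta> pos_nonzero by (simp add: P_iff)
  qed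
  ultimately show ?thesis by blast
qed

definition theta_dual :: "('g \<Rightarrow> complex) \<Rightarrow> 'g \<Rightarrow> complex" where
  "theta_dual f = (\<lambda>A. f (\<theta> A))"

lemma theta_dual_D: "f \<in> D \<Longrightarrow> theta_dual f \<in> D"
  by (auto simp: dual_space_def theta_dual_def theta_add theta_scale theta_t)

lemma theta_dual_thT: "theta_dual (theta_dual f) = f"
  by (simp add: theta_dual_def theta_theta)

text \<open>The automorphism \<open>\<theta>\<close> preserves \<open>t\<close> and carries root vectors to root vectors.\<close>

lemma theta_dual_root: assumes "\<alpha> \<in> roots t" shows "theta_dual \<alpha> \<in> roots t"
proof -
  obtain x where x: "weight_vector \<alpha> x" using roots_weights[OF assms] by (auto simp: weights_def)
  have "br A (\<theta> x) = scale (\<alpha> (\<theta> A)) (\<theta> x)" if "A \<in> t" for A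
  proof -
    have "br A (\<theta> x) = \<theta> (br (\<theta> A) x)" by (simp add: theta_br theta_theta)
    also have "br (\<theta> A) x = scale (\<alpha> (\<theta> A)) x" using x that by (simp add: weight_vector_def theta_t)
    finally show ?thesis by (simp add: theta_scale)
  qed
  moreover have "\<theta> x \<noteq> 0" using x theta_theta[of x] theta_scale[of 0 0] by (auto simp: weight_vector_def)
  ultimately have "weight_vector (theta_dual \<alpha>) (\<theta> x)" by (simp add: weight_vector_def theta_dual_def)
  moreover have "theta_dual \<alpha> \<noteq> (\<lambda>_. 0)"
  proof
    assume "theta_dual \<alpha> = (\<lambda>_. 0)"
    then have "\<alpha> = theta_dual (\<lambda>_. 0)" using theta_dual_thT[of \<alpha>] by simp
    then show False using assms by (simp add: theta_dual_def weights_0_roots)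
  qed
  ultimately show ?thesis using theta_dual_D[OF roots_D[OF assms]] by (auto simp: weights_0_roots weights_def)
qed

lemma theta_dual_a: "A \<in> a \<Longrightarrow> f \<in> D \<Longrightarrow> theta_dual f A = - f A"
  using dual_scale[of f A "-1"] by (simp add: theta_dual_def theta_p a_sub tR_t tRI)

text \<open>On \<open>tR\<close> the map \<open>\<theta>\<close> only changes the sign of the component in \<open>a\<close>.\<close>

lemma theta_dual_fixed: assumes f: "f \<in> D" and van: "\<And>A. A \<in> a \<Longrightarrow> f A = 0" shows "theta_dual f = f"
proof (rule dual_eqI[OF theta_dual_D[OF f] f])
  fix v assume "v \<in> set vs"
  then obtain x y where xy: "x \<in> hp" "y \<in> a" "v = scale \<i> x + y" using vs_tR by (metis tRE)
  then have "\<theta> v = scale \<i> x + scale (- 1) y"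
    by (simp add: theta_add theta_scale theta_k theta_p hp_sub a_sub)
  moreover have "scale \<i> x \<in> t" "y \<in> t" using xy by (auto intro: tRI tR_t)
  ultimately show "theta_dual f v = f v"
    using f van[OF xy(2)]
    by (simp only: theta_dual_def xy(3) dual_add dual_scale subspace_scale[OF subspace_t]) simp
qed

lemma theta_dual_isometry: assumes "f \<in> D" "g \<in> D" shows "df (theta_dual f) (theta_dual g) = df f g"
proof -
  have dv: "dv (theta_dual f) = \<theta> (dv f)" if "f \<in> D" for f
  proof (rule dual_vectorI)
    show "\<theta> (dv f) \<in> t" using that by (simp add: theta_t dual_vector)
    fix A assume "A \<in> t"
    have "B (\<theta> (dv f)) A = B (\<theta> (dv f)) (\<theta> (\<theta> A))" by (simp add: theta_theta)
    also have "\<dots> = B (dv f) (\<theta> A)" by (rule B_theta)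
    finally show "B (\<theta> (dv f)) A = theta_dual f A"
      using that \<open>A \<in> t\<close> by (simp add: dual_vector theta_t theta_dual_def)
  qed
  show ?thesis using assms by (simp add: dual_form_def dv B_theta)
qed

lemma dual_form_uminus: "f \<in> D \<Longrightarrow> g \<in> D \<Longrightarrow> df (- f) (- g) = df f g"
proof -
  assume f: "f \<in> D" "g \<in> D"
  have u: "df (- f) g = - df f g" if "f \<in> D" "g \<in> D" for f g
    using that by (simp add: dual_form_eval dual_space_uminus)
  have "df (- f) (- g) = - df (- g) f"
    using f u[of f "- g"] by (simp add: dual_space_uminus dual_form_sym[of f "- g"])
  then show ?thesis using f u[of g f] by (simp add: dual_form_sym[of g f])
qed

end

locale real_form_longest = real_form_data +
  fixes w :: "('a \<Rightarrow> complex) \<Rightarrow> 'a \<Rightarrow> complex"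
  assumes longest: "longest_element t Pi_bullet w"
begin

text \<open>The linear isometry of the dual space of \<open>t\<close> that induces the diagram automorphism.\<close>

definition phi :: "('a \<Rightarrow> complex) \<Rightarrow> 'a \<Rightarrow> complex" where
  "phi f = - w (theta_dual f)"

lemma w_word: obtains \<alpha>s where "set \<alpha>s \<subseteq> Pi_bullet" "set \<alpha>s \<subseteq> roots t" "w = word \<alpha>s"
proof -
  obtain \<alpha>s where as: "set \<alpha>s \<subseteq> Pi_bullet" "w = word \<alpha>s"
    using reflection_group_word[OF Pi_bullet_roots] longest by (auto simp: longest_element_def)
  then show ?thesis using that Pi_bullet_roots by blast
qed

lemma phi_isometry: assumes "f \<in> D" "g \<in> D" shows "df (phi f) (phi g) = df f g"
proof -
  obtain \<alpha>s where as: "set \<alpha>s \<subseteq> roots t" "w = word \<alpha>s" by (rule w_word)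
  show ?thesis
    unfolding phi_def unfolding as(2)
    using assms as(1) by (simp add: dual_form_uminus word_D theta_dual_D word_isometry theta_dual_isometry)
qed

lemma phi_add: assumes "f \<in> D" "g \<in> D" shows "phi (\<lambda>A. f A + g A) = (\<lambda>A. phi f A + phi g A)"
proof -
  obtain \<alpha>s where as: "set \<alpha>s \<subseteq> roots t" "w = word \<alpha>s" by (rule w_word)
  have "theta_dual (\<lambda>A. f A + g A) = (\<lambda>A. theta_dual f A + theta_dual g A)" by (simp add: theta_dual_def)
  then show ?thesis
    using word_add[OF as(1) theta_dual_D[OF assms(1)] theta_dual_D[OF assms(2)], of 1]
    unfolding phi_def unfolding as(2) by (simp add: fun_Compl_def)
qed

lemma phi_inj: "inj_on phi D"
proof (rule inj_onI)
  fix f g assume fg: "f \<in> D" "g \<in> D" "phi f = phi g"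
  obtain \<alpha>s where as: "set \<alpha>s \<subseteq> roots t" "w = word \<alpha>s" by (rule w_word)
  have "w (theta_dual f) = w (theta_dual g)" using fg(3) by (simp add: phi_def fun_eq_iff)
  then have "theta_dual f = theta_dual g"
    using word_Bij[OF as(1)] fg theta_dual_D as(2) by (auto simp: Bij_def bij_betw_def dest: inj_onD)
  then show "f = g" by (metis theta_dual_thT)
qed

lemma phi_reflected:
  assumes "\<alpha> \<in> roots t" shows "phi \<alpha> = w (- theta_dual \<alpha>)"
proof -
  obtain \<alpha>s where as: "set \<alpha>s \<subseteq> roots t" "w = word \<alpha>s" by (rule w_word)
  show ?thesis
    unfolding phi_def unfolding as(2) using assms as(1) by (simp add: word_uminus theta_dual_D roots_D)
qed

lemma phi_root: assumes "\<alpha> \<in> roots t" shows "phi \<alpha> \<in> roots t"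
proof -
  obtain \<alpha>s where as: "set \<alpha>s \<subseteq> roots t" "w = word \<alpha>s" by (rule w_word)
  show ?thesis
    unfolding phi_def unfolding as(2) using assms as(1) by (simp add: uminus_root word_root theta_dual_root)
qed

lemma phi_restriction: assumes "\<alpha> \<in> roots t" "A \<in> a" shows "phi \<alpha> A = \<alpha> A"
proof -
  obtain \<alpha>s where as: "set \<alpha>s \<subseteq> Pi_bullet" "w = word \<alpha>s" by (rule w_word)
  show ?thesis
    unfolding phi_def unfolding as(2)
    using assms word_restriction[OF as(1) theta_dual_root[OF assms(1)] assms(2)] by (simp add: theta_dual_a roots_D)
qed

text \<open>On a root that does not vanish on \<open>a\<close> the restriction to \<open>a\<close> is unchanged: \<open>\<theta>\<close> contributes a sign
  that cancels the one in \<open>phi\<close>, and \<open>w\<close> only adds combinations of \<open>Pi_bullet\<close>. On a root that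
  vanishes on \<open>a\<close> the map is \<open>- w\<close>, and \<open>w\<close> makes such positive roots negative.\<close>

lemma phi_P: assumes "\<alpha> \<in> P" shows "phi \<alpha> \<in> P"
proof (cases "\<exists>A\<in>a. \<alpha> A \<noteq> 0")
  case True
  have \<alpha>: "\<alpha> \<in> roots t" "pos \<alpha>" using assms by (auto simp: P_iff)
  have "pos (phi \<alpha>)" by (rule pos_by_restriction[OF roots_D[OF \<alpha>(1)] \<alpha>(2) True phi_restriction[OF \<alpha>(1)]])
  then show ?thesis using phi_root[OF \<alpha>(1)] by (simp add: P_iff)
next
  case False
  have \<alpha>: "\<alpha> \<in> roots t" "pos \<alpha>" using assms by (auto simp: P_iff)
  have "theta_dual \<alpha> = \<alpha>" using False by (intro theta_dual_fixed roots_D \<alpha>) auto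
  then have "pos (phi \<alpha>)"
    using longest_element_bullet_negative[OF longest assms] False by (simp add: phi_def)
  then show ?thesis using phi_root[OF \<alpha>(1)] by (simp add: P_iff)
qed

lemma phi_P_onto: "phi ` P = P"
proof (rule card_subset_eq[OF finite_P])
  show "phi ` P \<subseteq> P" using phi_P by auto
  have "P \<subseteq> D" by (auto simp: P_iff roots_D)
  then show "card (phi ` P) = card P" by (intro card_image inj_on_subset[OF phi_inj])
qed

text \<open>An additive bijection of the positive roots preserves indecomposability.\<close>

lemma phi_Pi: assumes "\<alpha> \<in> Pi_roots" shows "phi \<alpha> \<in> Pi_roots"
proof -
  have PD: "\<beta> \<in> D" if "\<beta> \<in> P" for \<beta> using that by (auto simp: P_iff roots_D)
  have "phi \<alpha> \<noteq> (\<lambda>A. \<beta> A + \<gamma> A)" if "\<beta> \<in> P" "\<gamma> \<in> P" for \<beta> \<gamma>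
  proof
    assume eq: "phi \<alpha> = (\<lambda>A. \<beta> A + \<gamma> A)"
    have "\<beta> \<in> phi ` P" "\<gamma> \<in> phi ` P" using that by (simp_all only: phi_P_onto)
    then obtain \<beta>' \<gamma>' where *: "\<beta>' \<in> P" "\<gamma>' \<in> P" "\<beta> = phi \<beta>'" "\<gamma> = phi \<gamma>'"
      by (elim imageE)
    then have "phi \<alpha> = phi (\<lambda>A. \<beta>' A + \<gamma>' A)" using eq by (simp add: phi_add PD)
    moreover have "(\<lambda>A. \<beta>' A + \<gamma>' A) \<in> D" using dual_space_add[OF PD PD, of \<beta>' \<gamma>' 1] * by simp
    ultimately have "\<alpha> = (\<lambda>A. \<beta>' A + \<gamma>' A)"
      using inj_onD[OF phi_inj] PD[OF Pi_P[OF assms]] by blast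
    then show False using Pi_indecomposable[OF assms *(1,2)] by simp
  qed
  moreover have "phi \<alpha> \<in> P" using phi_P Pi_P assms by blast
  ultimately show ?thesis by (auto simp: Pi_roots_def simple_roots_def)
qed

lemma phi_bij: "bij_betw phi Pi_roots Pi_roots"
proof -
  have inj: "inj_on phi Pi_roots"
    by (rule inj_on_subset[OF phi_inj]) (auto simp: roots_D Pi_roots)
  moreover have "phi ` Pi_roots = Pi_roots"
    by (rule endo_inj_surj[OF finite_Pi _ inj]) (auto simp: phi_Pi)
  ultimately show ?thesis by (simp add: bij_betw_def)
qed

text \<open>The root \<open>\<delta> = - \<theta>\<^sup>T \<alpha>\<close> is positive and differs from \<open>phi \<alpha> = w \<delta>\<close> by an integral combination of
  \<open>Pi_bullet\<close>. The integers are coefficients of \<open>\<delta>\<close> in the simple roots, hence nonnegative.\<close>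

lemma satake_relation:
  assumes \<alpha>: "\<alpha> \<in> Pi_circ"
  shows "\<exists>c :: _ \<Rightarrow> nat. \<forall>A\<in>t. \<alpha> (\<theta> A) = - phi \<alpha> A - (\<Sum>\<gamma>\<in>Pi_bullet. of_nat (c \<gamma>) * \<gamma> A)"
proof -
  have aPi: "\<alpha> \<in> Pi_roots" and aR: "\<alpha> \<in> roots t" using \<alpha> Pi_roots by (auto simp: Pi_circ_def)
  let ?\<delta> = "- theta_dual \<alpha>" and ?\<beta> = "phi \<alpha>"
  have dR: "?\<delta> \<in> roots t" using aR by (intro uminus_root theta_dual_root)
  have res: "?\<delta> A = \<alpha> A" if "A \<in> a" for A using that aR by (simp add: theta_dual_a roots_D)
  have nz: "\<exists>A\<in>a. \<alpha> A \<noteq> 0" using \<alpha> aPi by (auto simp: Pi_circ_def Pi_bullet_def)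
  have "pos ?\<delta>" by (rule pos_by_restriction[OF roots_D[OF aR] Pi_pos[OF aPi] nz res])
  then have dP: "?\<delta> \<in> P" using dR by (simp add: P_iff)
  have bPi: "?\<beta> \<in> Pi_roots" by (rule phi_Pi[OF aPi])
  have bB: "?\<beta> \<notin> Pi_bullet" using nz phi_restriction[OF aR] by (auto simp: Pi_bullet_def)
  obtain \<alpha>s where as: "set \<alpha>s \<subseteq> Pi_bullet" "w = word \<alpha>s" by (rule w_word)
  obtain c :: "_ \<Rightarrow> int" where c: "?\<beta> = (\<lambda>A. ?\<delta> A - lincomb (\<lambda>\<gamma>. of_int (c \<gamma>)) Pi_bullet A)"
    using word_translation[OF as(1) dR] unfolding phi_reflected[OF aR] unfolding as(2) by blast
  obtain n :: "_ \<Rightarrow> nat" where n: "?\<delta> = lincomb (\<lambda>\<gamma>. of_nat (n \<gamma>)) Pi_roots"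
    using positive_root_simple_combination[OF dP] by blast
  have "lincomb (\<lambda>\<gamma>. of_nat (n \<gamma>)) Pi_roots =
      lincomb (\<lambda>\<gamma>. (if \<gamma> = ?\<beta> then 1 else 0) + (if \<gamma> \<in> Pi_bullet then of_int (c \<gamma>) else 0)) Pi_roots"
  proof
    fix A
    have "lincomb (\<lambda>\<gamma>. if \<gamma> \<in> Pi_bullet then of_int (c \<gamma>) else 0) Pi_roots A = lincomb (\<lambda>\<gamma>. of_int (c \<gamma>)) Pi_bullet A"
      unfolding lincomb_def using finite_Pi Pi_bullet_Pi by (intro sum.mono_neutral_cong_right) auto
    then have "lincomb (\<lambda>\<gamma>. (if \<gamma> = ?\<beta> then 1 else 0) + (if \<gamma> \<in> Pi_bullet then of_int (c \<gamma>) else 0)) Pi_roots A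
        = lincomb (\<lambda>\<gamma>. if \<gamma> = ?\<beta> then 1 else 0) Pi_roots A + lincomb (\<lambda>\<gamma>. of_int (c \<gamma>)) Pi_bullet A"
      by (simp add: lincomb_def sum.distrib distrib_right)
    also have "\<dots> = ?\<delta> A"
      using fun_cong[OF c, of A] bPi by (simp add: lincomb_single finite_Pi)
    finally show "lincomb (\<lambda>\<gamma>. of_nat (n \<gamma>)) Pi_roots A =
      lincomb (\<lambda>\<gamma>. (if \<gamma> = ?\<beta> then 1 else 0) + (if \<gamma> \<in> Pi_bullet then of_int (c \<gamma>) else 0)) Pi_roots A"
      by (simp only: n)
  qed
  from simple_coefficients_unique[OF this]
  have "of_int (c \<gamma>) = real (n \<gamma>)" if "\<gamma> \<in> Pi_bullet" for \<gamma>
    using that bB Pi_bullet_Pi by force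
  then have "lincomb (\<lambda>\<gamma>. of_int (c \<gamma>)) Pi_bullet = lincomb (\<lambda>\<gamma>. of_nat (n \<gamma>)) Pi_bullet"
    by (auto simp: lincomb_def intro!: sum.cong)
  then have "?\<beta> A = - \<alpha> (\<theta> A) - (\<Sum>\<gamma>\<in>Pi_bullet. of_nat (n \<gamma>) * \<gamma> A)" for A
    using fun_cong[OF c, of A] by (simp add: lincomb_def theta_dual_def)
  then have "\<forall>A\<in>t. \<alpha> (\<theta> A) = - phi \<alpha> A - (\<Sum>\<gamma>\<in>Pi_bullet. of_nat (n \<gamma>) * \<gamma> A)"
    by simp
  then show ?thesis by blast
qed

text \<open>Independence of the simple roots determines the root in \<open>Pi_circ\<close> that occurs in the defining relation
  of \<open>omega\<close>.\<close>

lemma omega_phi: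
  assumes \<alpha>: "\<alpha> \<in> Pi_circ"
  shows "omega \<alpha> = phi \<alpha>"
proof -
  have aPi: "\<alpha> \<in> Pi_roots" and aR: "\<alpha> \<in> roots t" using \<alpha> Pi_roots by (auto simp: Pi_circ_def)
  have nz: "\<exists>A\<in>a. \<alpha> A \<noteq> 0" using \<alpha> aPi by (auto simp: Pi_circ_def Pi_bullet_def)
  have circ: "phi \<alpha> \<in> Pi_circ"
    using phi_Pi[OF aPi] nz phi_restriction[OF aR] by (auto simp: Pi_circ_def Pi_bullet_def)
  have unique: "\<beta> = \<beta>'" if b: "\<beta> \<in> Pi_circ" "\<beta>' \<in> Pi_circ"
    and c: "\<forall>A\<in>t. \<alpha> (\<theta> A) = - \<beta> A - (\<Sum>\<gamma>\<in>Pi_bullet. of_nat (c \<gamma>) * \<gamma> A)"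
    and d: "\<forall>A\<in>t. \<alpha> (\<theta> A) = - \<beta>' A - (\<Sum>\<gamma>\<in>Pi_bullet. of_nat (d \<gamma>) * \<gamma> A)"
    for \<beta> \<beta>' and c d :: "_ \<Rightarrow> nat"
  proof (rule ccontr)
    assume ne: "\<beta> \<noteq> \<beta>'"
    have bb: "\<beta> \<in> Pi_roots" "\<beta> \<notin> Pi_bullet" "\<beta>' \<in> Pi_roots" using b by (auto simp: Pi_circ_def)
    let ?l = "\<lambda>\<beta> c. \<lambda>\<gamma>. (if \<gamma> = \<beta> then 1 else 0) + (if \<gamma> \<in> Pi_bullet then of_nat (c \<gamma>) else 0)"
    have l: "lincomb (?l \<beta> c) Pi_roots A = \<beta> A + (\<Sum>\<gamma>\<in>Pi_bullet. of_nat (c \<gamma>) * \<gamma> A)"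
      if "\<beta> \<in> Pi_roots" for \<beta> A and c :: "_ \<Rightarrow> nat"
    proof -
      have "lincomb (\<lambda>\<gamma>. if \<gamma> \<in> Pi_bullet then of_nat (c \<gamma>) else 0) Pi_roots A = (\<Sum>\<gamma>\<in>Pi_bullet. of_nat (c \<gamma>) * \<gamma> A)"
        unfolding lincomb_def using finite_Pi Pi_bullet_Pi by (intro sum.mono_neutral_cong_right) auto
      moreover have "lincomb (?l \<beta> c) Pi_roots A = lincomb (\<lambda>\<gamma>. if \<gamma> = \<beta> then 1 else 0) Pi_roots A +
          lincomb (\<lambda>\<gamma>. if \<gamma> \<in> Pi_bullet then of_nat (c \<gamma>) else 0) Pi_roots A"
        by (simp add: lincomb_def sum.distrib distrib_right)
      ultimately show ?thesis using that by (simp add: lincomb_single finite_Pi)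
    qed
    have "lincomb (?l \<beta> c) Pi_roots = lincomb (?l \<beta>' d) Pi_roots"
    proof (rule dual_eqI)
      show "lincomb (?l \<beta> c) Pi_roots \<in> D" "lincomb (?l \<beta>' d) Pi_roots \<in> D" by (rule real_dual_D, rule lincomb_real_dual[OF Pi_real_dual])+
      fix v assume "v \<in> set vs"
      then have "v \<in> t" by (simp add: vs_tR tR_t)
      then have "- \<beta> v - (\<Sum>\<gamma>\<in>Pi_bullet. of_nat (c \<gamma>) * \<gamma> v) = - \<beta>' v - (\<Sum>\<gamma>\<in>Pi_bullet. of_nat (d \<gamma>) * \<gamma> v)"
        by (rule trans[OF bspec[OF c, symmetric] bspec[OF d]]) fact
      then have "\<beta> v + (\<Sum>\<gamma>\<in>Pi_bullet. of_nat (c \<gamma>) * \<gamma> v) = \<beta>' v + (\<Sum>\<gamma>\<in>Pi_bullet. of_nat (d \<gamma>) * \<gamma> v)"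
        by (simp add: algebra_simps)
      then show "lincomb (?l \<beta> c) Pi_roots v = lincomb (?l \<beta>' d) Pi_roots v"
        using bb by (simp only: l)
    qed
    from simple_coefficients_unique[OF this bb(1)] show False using ne bb by simp
  qed
  show ?thesis
    unfolding omega_def
  proof (rule the_equality)
    show "phi \<alpha> \<in> Pi_circ \<and> (\<exists>c :: _ \<Rightarrow> nat. \<forall>A\<in>t.
        \<alpha> (\<theta> A) = - phi \<alpha> A - (\<Sum>\<gamma>\<in>Pi_bullet. of_nat (c \<gamma>) * \<gamma> A))"
      using circ satake_relation[OF \<alpha>] by blast
  next
    fix \<beta> assume "\<beta> \<in> Pi_circ \<and> (\<exists>c :: _ \<Rightarrow> nat. \<forall>A\<in>t.
        \<alpha> (\<theta> A) = - \<beta> A - (\<Sum>\<gamma>\<in>Pi_bullet. of_nat (c \<gamma>) * \<gamma> A))"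
    then show "\<beta> = phi \<alpha>" using unique[OF _ circ] satake_relation[OF \<alpha>] by blast
  qed
qed

lemma epsilon_phi: assumes "\<alpha> \<in> Pi_roots" shows "epsilon w \<alpha> = phi \<alpha>"
proof (cases "\<alpha> \<in> Pi_bullet")
  case True
  then have "theta_dual \<alpha> = \<alpha>" using assms by (intro theta_dual_fixed roots_D Pi_roots) (auto simp: Pi_bullet_a)
  then show ?thesis using True by (simp add: epsilon_def phi_def)
next
  case False
  then show ?thesis using assms omega_phi[of \<alpha>] by (simp add: epsilon_def Pi_circ_def)
qed

lemma dynkin_automorphism_epsilon: "dynkin_automorphism t Pi_roots (epsilon w)"
proof -
  have df: "df (epsilon w \<alpha>) (epsilon w \<beta>) = df \<alpha> \<beta>" if "\<alpha> \<in> Pi_roots" "\<beta> \<in> Pi_roots" for \<alpha> \<beta>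
    using that by (simp add: epsilon_phi phi_isometry roots_D Pi_roots)
  have "bij_betw (epsilon w) Pi_roots Pi_roots"
    using phi_bij by (simp add: epsilon_phi cong: bij_betw_cong)
  then show ?thesis
    by (simp add: dynkin_automorphism_def dynkin_arrow_def dynkin_edges_def cartan_number_def df)
qed

end

theorem proposition3p1:
  fixes scale :: "complex \<Rightarrow> 'g::ab_group_add \<Rightarrow> 'g" and br :: "'g \<Rightarrow> 'g \<Rightarrow> 'g"
    and g0 :: "'g set" and \<sigma> :: "'g \<Rightarrow> 'g"
    and k p :: "'g set" and \<theta> :: "'g \<Rightarrow> 'g"
    and a hp :: "'g set" and vs :: "'g list" and r :: nat
    and w :: "('g \<Rightarrow> complex) \<Rightarrow> 'g \<Rightarrow> complex"
  assumes "real_form_data scale br g0 \<sigma> k p \<theta> a hp vs r"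
    and "complex_lie_algebra.longest_element scale br (real_form_data.t scale a hp)
           (real_form_data.Pi_bullet scale br a hp vs) w"
  shows "complex_lie_algebra.dynkin_automorphism scale br (real_form_data.t scale a hp)
           (real_form_data.Pi_roots scale br a hp vs)
           (real_form_data.epsilon scale br \<theta> a hp vs w)"
proof -
  interpret real_form_longest scale br g0 \<sigma> k p \<theta> a hp vs r w
    using assms by (simp add: real_form_longest_def real_form_longest_axioms_def)
  show ?thesis by (rule dynkin_automorphism_epsilon)
qed

end
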